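(* Let $\{m_k\}_{k=1}^\infty\subset\mathbb{C}$ and $m_0=1$. Let $M=(M_{ij})_{i,j\ge1}$ be the infinite matrix with $M_{ij}=m_{i+j-2}$ if $j$ is odd and $M_{ij}=\overline{m_{i+j-2}}$ if $j$ is even. Then there exists a biradial measure $\rho$ on $\mathbb{C}$ with finite moments such that $$m_k=\int_{\mathbb{C}}\langle\lambda\rangle^k\,d\rho(\lambda)\qquad\text{for all }k=0,1,2,\dots$$ if and only if for every $k\ge1$ the leading $k\times k$ submatrix $(M_{ij})_{1\le i,j\le k}$ is positive semidefinite.
   Context: For integers $k\ge0$, $\langle\lambda\rangle^k=|\lambda|^k$ if $k$ is even and $\langle\lambda\rangle^k=\lambda|\lambda|^{k-1}$ if $k$ is odd. A positive semidefinite complex matrix is in particular Hermitian. Biradial measures: write $\mathbb{R}^+=[0,\infty)$. Let $\rho_1^+,\rho_2^+$ be positive Borel measures on $\mathbb{R}^+$ with $\rho_1^+(\mathbb{R}^+)+\rho_2^+(\mathbb{R}^+)=1$, and let $\phi_1,\phi_2:\mathbb{R}^+\to\mathbb{R}$ be Borel measurable. For Borel $E\subset\mathbb{C}$ put $\rho_j(E)=\rho_j^+(\{r\ge0: re^{i\phi_j(r)}\in E\})$, $j=1,2$. The probability measure $\rho=\rho_1+\rho_2$ on $\mathbb{C}$ is called a biradial measure. It has finite moments if $\int_{\mathbb{C}}|\lambda|^n\,d\rho(\lambda)<\infty$ for all $n=0,1,2,\dots$. *)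

theory Defs
  imports "HOL-Analysis.Analysis" "Jordan_Normal_Form.Schur_Decomposition"
begin

definition angle_power :: "complex \<Rightarrow> nat \<Rightarrow> complex" where
  "angle_power z k =
     (if even k then of_real (cmod z ^ k) else z * of_real (cmod z ^ (k - 1)))"

definition biradial :: "complex measure \<Rightarrow> bool" where
  "biradial \<rho> \<longleftrightarrow> sets \<rho> = sets borel \<and>
     (\<exists>(\<rho>1 :: real measure) (\<rho>2 :: real measure) (\<phi>1 :: real \<Rightarrow> real) (\<phi>2 :: real \<Rightarrow> real).
        sets \<rho>1 = sets (restrict_space borel {0..}) \<and>
        sets \<rho>2 = sets (restrict_space borel {0..}) \<and>
        emeasure \<rho>1 {0..} + emeasure \<rho>2 {0..} = 1 \<and>
        \<phi>1 \<in> borel_measurable (restrict_space borel {0..}) \<and>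
        \<phi>2 \<in> borel_measurable (restrict_space borel {0..}) \<and>
        (\<forall>E\<in>sets borel. emeasure \<rho> E =
           emeasure \<rho>1 {r. 0 \<le> r \<and> of_real r * exp (\<i> * of_real (\<phi>1 r)) \<in> E} +
           emeasure \<rho>2 {r. 0 \<le> r \<and> of_real r * exp (\<i> * of_real (\<phi>2 r)) \<in> E}))"

definition finite_moments :: "complex measure \<Rightarrow> bool" where
  "finite_moments \<rho> \<longleftrightarrow> (\<forall>n::nat. (\<integral>\<^sup>+ z. ennreal (cmod z ^ n) \<partial>\<rho>) < \<infinity>)"

text \<open>Indices start at 1, so the truncated subtraction in \<open>i + j - 2\<close> is harmless; the value at
  index 0 is irrelevant.\<close>

definition moment_matrix :: "(nat \<Rightarrow> complex) \<Rightarrow> nat \<Rightarrow> nat \<Rightarrow> complex" where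
  "moment_matrix m i j = (if odd j then m (i + j - 2) else cnj (m (i + j - 2)))"

text \<open>Entries of type \<open>mat\<close> are indexed from 0, hence the shift.\<close>

definition leading_submatrix :: "(nat \<Rightarrow> nat \<Rightarrow> complex) \<Rightarrow> nat \<Rightarrow> complex mat" where
  "leading_submatrix M k = mat k k (\<lambda>(i, j). M (i + 1) (j + 1))"

text \<open>The order on \<open>complex\<close> is that of \<open>Complex_Order\<close>: \<open>0 \<le> z\<close> says that \<open>z\<close> is real and
  nonnegative. The expression \<open>(A *\<^sub>v v) \<bullet>c v\<close> is the quadratic form \<open>v\<^sup>* A v\<close>.\<close>

definition positive_semidefinite :: "complex mat \<Rightarrow> bool" where
  "positive_semidefinite A \<longleftrightarrow> square_mat A \<and> mat_adjoint A = A \<and>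
     (\<forall>v \<in> carrier_vec (dim_row A). 0 \<le> (A *\<^sub>v v) \<bullet>c v)"

end

theory Submission
  imports Defs "HOL-Probability.Helly_Selection"
begin

text \<open>
  If \<open>m\<close> is given by a measure, then \<open>M\<^sub>a\<^sub>b\<close> (indexed from 0) is the integral of
  \<open>\<langle>\<lambda>\<rangle>\<^sup>a\<close> times the conjugate of \<open>\<langle>\<lambda>\<rangle>\<^sup>b\<close>, so \<open>M\<close> is a Gram matrix.

  Conversely, \<open>M\<close> defines a semi-inner product on polynomials for which the antilinear shift
  \<open>A\<close> is symmetric. Compress \<open>A\<close> to degree at most \<open>n\<close> and decompose the vector 1 into
  eigenvectors \<open>x\<^sub>i\<close> of the positive linear operator \<open>A\<^sup>2\<close> with eigenvalues \<open>d\<^sub>i\<^sup>2\<close>. The even moments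
  are those of the masses \<open>w\<^sub>i = \<parallel>x\<^sub>i\<parallel>\<^sup>2\<close> at \<open>d\<^sub>i\<close>, and \<open>\<bar>\<langle>A x\<^sub>i, x\<^sub>i\<rangle>\<bar> \<le> d\<^sub>i w\<^sub>i\<close> gives the odd
  moments a density \<open>h\<^sub>i\<close> in the closed unit disc with respect to these masses. Such finitely
  atomic representations of \<open>m\<^sub>0, \<dots>, m\<^sub>n\<close> are passed to the limit by Helly's theorem, and the
  density survives by Radon--Nikodym. Finally, every point of the disc is the average of two points
  of the unit circle, whose arguments are the phases of the biradial measure.
\<close>

section \<open>Symmetric antilinear operators\<close>

text \<open>Degenerate forms are allowed, because the moment matrix may be singular. Instead of
  passing to the quotient, the arguments below work modulo null vectors, which are orthogonal to
  everything.\<close>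

locale psd_form = vector_space scale
  for scale :: "complex \<Rightarrow> 'v::ab_group_add \<Rightarrow> 'v" (infixr \<open>*c\<close> 75) +
  fixes B :: "'v \<Rightarrow> 'v \<Rightarrow> complex"
  assumes add_left: "B (x + y) z = B x z + B y z"
    and scale_left: "B (c *c x) z = c * B x z"
    and hermitian: "B y x = cnj (B x y)"
    and Re_nonneg: "0 \<le> Re (B x x)"
begin

lemma add_right: "B x (y + z) = B x y + B x z"
  by (metis add_left complex_cnj_add hermitian)

lemma scale_right: "B x (c *c y) = cnj c * B x y"
  by (metis scale_left complex_cnj_mult hermitian)

lemma diff_left: "B (x - y) z = B x z - B y z"
  by (metis add_left add_diff_cancel_right' diff_add_cancel)

lemma diff_right: "B x (y - z) = B x y - B x z"
  by (metis add_right add_diff_cancel_right' diff_add_cancel)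

lemma zero_left [simp]: "B 0 x = 0"
  by (metis diff_left diff_self)

lemma zero_right [simp]: "B x 0 = 0"
  by (metis diff_right diff_self)

lemma sum_left: "B (sum f I) y = (\<Sum>i\<in>I. B (f i) y)"
  by (induction I rule: infinite_finite_induct) (auto simp: add_left)

lemma self_eq_Re: "B x x = of_real (Re (B x x))"
  by (metis Reals_cnj_iff hermitian of_real_Re)

lemma self_diff_scale:
  "Re (B (x - t *c y) (x - t *c y)) =
    Re (B x x) - 2 * Re (cnj t * B x y) + (cmod t)\<^sup>2 * Re (B y y)"
proof -
  have "B (x - t *c y) (x - t *c y) = B x x - cnj t * B x y - (t * B y x - t * cnj t * B y y)"
    by (simp add: diff_left diff_right scale_left scale_right algebra_simps)
  moreover have "t * B y x = cnj (cnj t * B x y)"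
    by (metis complex_cnj_cnj complex_cnj_mult hermitian)
  moreover have "t * cnj t * B y y = of_real ((cmod t)\<^sup>2 * Re (B y y))"
    by (metis complex_norm_square of_real_mult self_eq_Re)
  ultimately show ?thesis by simp
qed

text \<open>For null \<open>y\<close> the squared seminorm of \<open>x - (s * b) *c y\<close> is
  affine in the real number \<open>s\<close>, with slope \<open>- 2 * (cmod b)\<^sup>2\<close>.
  Being nonnegative for every \<open>s\<close>, it has slope 0.\<close>

lemma null_left: 
  assumes "B y y = 0"
  shows "B y x = 0"
proof -
  define b where "b = B x y"
  have "0 \<le> Re (B x x) - 2 * s * (cmod b)\<^sup>2" for s :: real
  proof -
    have "Re (cnj (of_real s * b) * b) = s * (cmod b)\<^sup>2"
      unfolding cmod_power2 by (simp add: algebra_simps power2_eq_square)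
    then show ?thesis
      using Re_nonneg[of "x - (of_real s * b) *c y"] self_diff_scale[of x "of_real s * b" y] assms
      by (simp add: b_def)
  qed
  note * = this
  have "b = 0"
  proof (rule ccontr)
    assume "b \<noteq> 0"
    then show False
      using *[of "(Re (B x x) + 1) / (2 * (cmod b)\<^sup>2)"] by (simp add: field_simps)
  qed
  then show ?thesis by (metis b_def complex_cnj_zero hermitian)
qed

lemma null_right: "B y y = 0 \<Longrightarrow> B x y = 0"
  by (metis complex_cnj_zero hermitian null_left)

lemma Cauchy_Schwarz: "(cmod (B x y))\<^sup>2 \<le> Re (B x x) * Re (B y y)"
proof (cases "B y y = 0")
  case True
  then show ?thesis by (simp add: null_right)
next
  case False
  define r where "r = Re (B y y)"
  have r: "r > 0" 
    using False Re_nonneg[of y] self_eq_Re[of y] by (metis less_eq_real_def of_real_0 r_def)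
  define t where "t = B x y / of_real r"
  have "cnj t * B x y = of_real ((cmod (B x y))\<^sup>2 / r)"
    by (simp add: t_def complex_norm_square mult_ac del: of_real_power)
  then have "Re (cnj t * B x y) = (cmod (B x y))\<^sup>2 / r" by simp
  moreover have "(cmod t)\<^sup>2 * r = (cmod (B x y))\<^sup>2 / r"
    using r by (simp add: t_def norm_divide power_divide power2_eq_square)
  ultimately have "0 \<le> Re (B x x) - (cmod (B x y))\<^sup>2 / r"
    using Re_nonneg[of "x - t *c y"] self_diff_scale[of x t y] by (simp add: r_def)
  then show ?thesis using r by (simp add: field_simps r_def)
qed

lemma orthogonal_span:
  assumes "\<And>v. v \<in> T \<Longrightarrow> B x v = 0" "v \<in> span T"
  shows "B x v = 0"
  using assms(2)
  by (induction rule: span_induct_alt) (auto simp: add_right scale_right assms(1))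

text \<open>One Gram--Schmidt step per generator: \<open>t\<close> is replaced by its component
  \<open>u\<close> orthogonal to \<open>span T\<close>, and the projection is corrected along
  \<open>u\<close>.\<close>

lemma projection_exists:
  assumes "finite T"
  shows "\<exists>y\<in>span T. \<forall>v\<in>span T. B (z - y) v = 0"
  using assms
proof (induction T arbitrary: z rule: finite_induct)
  case empty
  then show ?case by auto
next
  case (insert t T)
  obtain s where s: "s \<in> span T" "\<forall>v\<in>span T. B (t - s) v = 0" using insert.IH by blast
  obtain y where y: "y \<in> span T" "\<forall>v\<in>span T. B (z - y) v = 0" using insert.IH by blast
  define u where "u = t - s"
  have sub: "span T \<subseteq> span (insert t T)" by (rule span_mono) auto
  have u: "u \<in> span (insert t T)"
    using s(1) sub unfolding u_def by (intro span_diff) (auto intro: span_base)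
  \<comment> \<open>For null \<open>u\<close> the quotient is 0 by convention; the equation
    \<open>c * B u u = B (z - y) u\<close> still holds, as both sides vanish.\<close>
  define c where "c = B (z - y) u / B u u"
  have cu: "c * B u u = B (z - y) u"
    by (cases "B u u = 0") (auto simp: c_def null_right)
  have t: "t = u + s" by (simp add: u_def)
  have "B (z - (y + c *c u)) v = 0" if "v \<in> insert t T" for v
  proof -
    have eq: "B (z - (y + c *c u)) v = B (z - y) v - c * B u v" for v
      by (simp add: diff_left add_left scale_left)
    have "B (z - (y + c *c u)) v = 0" if "v \<in> span T" for v
      using s(2) y(2) that unfolding eq by (simp add: u_def)
    moreover have "B (z - (y + c *c u)) u = 0" 
      using cu unfolding eq by simp
    ultimately show ?thesis 
      using that s(1) t by (metis add.right_neutral add_right insert_iff span_base)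
  qed
  then have "\<forall>v\<in>span (insert t T). B (z - (y + c *c u)) v = 0"
    by (meson orthogonal_span)
  moreover have "y + c *c u \<in> span (insert t T)"
    using y(1) sub u by (intro span_add span_scale) auto
  ultimately show ?case by blast
qed

end

text \<open>Both \<open>B (A x) y\<close> and \<open>B (A y) x\<close> are antilinear in
  \<open>x\<close> and in \<open>y\<close>, so \<open>A_sym\<close> is the notion of symmetry that
  fits an antilinear operator.\<close>

locale antilinear_symmetric = psd_form scale B
  for scale :: "complex \<Rightarrow> 'v::ab_group_add \<Rightarrow> 'v" (infixr \<open>*c\<close> 75) and B +
  fixes V :: "'v set" and A :: "'v \<Rightarrow> 'v"
  assumes V: "subspace V"
    and A_V: "x \<in> V \<Longrightarrow> A x \<in> V"
    and A_add: "A (x + y) = A x + A y"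
    and A_scale: "A (c *c x) = cnj c *c A x"
    and A_sym: "x \<in> V \<Longrightarrow> y \<in> V \<Longrightarrow> B (A x) y = B (A y) x"
begin

text \<open>The value of a polynomial at the complex linear operator \<open>A\<^sup>2\<close>, applied to a vector.\<close>

definition peval :: "complex poly \<Rightarrow> 'v \<Rightarrow> 'v" where
  "peval f v = fold_coeffs (\<lambda>a w. a *c v + A (A w)) f 0"

lemma A_zero [simp]: "A 0 = 0"
  by (metis A_add add_cancel_right_right)

lemma peval_0 [simp]: "peval 0 v = 0"
  by (simp add: peval_def)

lemma peval_pCons [simp]: "peval (pCons a f) v = a *c v + A (A (peval f v))"
  by (cases "a = 0 \<and> f = 0") (auto simp: peval_def fold_coeffs_pCons_not_0_0_eq fold_coeffs_pCons_coeff_not_0_eq)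

lemma peval_V: "v \<in> V \<Longrightarrow> peval f v \<in> V"
  by (induction f) (auto intro: V A_V subspace_add subspace_scale subspace_0)

lemma peval_add: "peval (f + g) v = peval f v + peval g v"
  by (induction f g rule: poly_induct2) (auto simp: A_add scale_left_distrib add_ac)

lemma peval_smult: "peval (Polynomial.smult c f) v = c *c peval f v"
  by (induction f) (auto simp: A_scale scale_right_distrib)

lemma peval_diff: "peval (f - g) v = peval f v - peval g v"
  by (metis peval_add add_diff_cancel_right' diff_add_cancel)

lemma peval_sum: "peval (sum f I) v = (\<Sum>i\<in>I. peval (f i) v)"
  by (induction I rule: infinite_finite_induct) (auto simp: peval_add)

lemma peval_mult: "peval (f * g) v = peval f (peval g v)"
  by (induction f) (auto simp: peval_add peval_smult)

lemma peval_monom: "peval (monom c j) v = c *c (A ^^ (2 * j)) v"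
  by (induction j) (auto simp: monom_0 monom_Suc A_scale)

lemma A_peval: "A (peval f v) = peval (map_poly cnj f) (A v)"
  by (induction f) (auto simp: A_add A_scale map_poly_pCons)

lemma map_poly_cnj_cnj [simp]: "map_poly cnj (map_poly cnj f) = f"
  by (rule poly_eqI) (simp add: coeff_map_poly)

lemma A2_sym: "x \<in> V \<Longrightarrow> y \<in> V \<Longrightarrow> B (A (A x)) y = B x (A (A y))"
  by (metis A_V A_sym hermitian)

lemma peval_adjoint:
  assumes "x \<in> V" "y \<in> V"
  shows "B (peval f x) y = B x (peval (map_poly cnj f) y)"
  using assms(2)
proof (induction f arbitrary: y)
  case (pCons a f)
  have "A (A (peval (map_poly cnj f) y)) = peval (map_poly cnj f) (A (A y))"
    by (simp add: A_peval)
  then show ?case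
    using pCons assms(1)
    by (auto simp: map_poly_pCons add_left scale_left add_right scale_right A2_sym peval_V A_V)
qed auto

text \<open>This is the source of positivity: the square of a symmetric antilinear operator has only
  nonnegative eigenvalues, whereas \<open>A\<close> itself has no spectrum to use.\<close>

lemma A_A_self: "x \<in> V \<Longrightarrow> B (A (A x)) x = B (A x) (A x)"
  using A_V A_sym by blast

text \<open>Otherwise the vectors \<open>(A ^^ (2 * j)) v\<close> for \<open>j \<le> card T\<close>
  would be \<open>card T + 1\<close> independent vectors in \<open>span T\<close>.\<close>

lemma annihilating_poly_exists:
  assumes T: "finite T" "V \<subseteq> span T" and v: "v \<in> V"
  shows "\<exists>p. p \<noteq> 0 \<and> peval p v = 0"
proof (rule ccontr)
  assume "\<not> ?thesis"
  then have nz: "p = 0" if "peval p v = 0" for p using that by blast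
  define g where "g j = peval (monom 1 j) v" for j
  have inj: "inj_on g {..card T}"
  proof (rule inj_onI)
    fix i j assume "g i = g j"
    then have "monom 1 i - monom 1 j = (0 :: complex poly)" 
      by (intro nz) (simp add: g_def peval_diff)
    then show "i = j" by (metis eq_iff_diff_eq_0 monom_eq_iff' zero_neq_one)
  qed
  have "independent (g ` {..card T})"
  proof (rule independent_if_scalars_zero)
    fix f x assume sum0: "(\<Sum>x\<in>g ` {..card T}. f x *c x) = 0" and "x \<in> g ` {..card T}"
    then obtain j where j: "x = g j" "j \<le> card T" by auto
    have "peval (\<Sum>j\<le>card T. monom (f (g j)) j) v = (\<Sum>j\<le>card T. f (g j) *c g j)"
      by (simp add: peval_sum g_def peval_monom)
    also have "\<dots> = 0" using sum0 inj by (simp add: sum.reindex)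
    finally have "(\<Sum>j\<le>card T. monom (f (g j)) j) = 0" by (rule nz)
    then have "coeff (\<Sum>j\<le>card T. monom (f (g j)) j) j = 0" by simp
    then show "f x = 0" using j by (simp add: coeff_sum)
  qed auto
  moreover have "g ` {..card T} \<subseteq> span T"
    using T v by (auto simp: g_def intro: peval_V subsetD)
  ultimately have "card (g ` {..card T}) \<le> card T"
    using independent_span_bound T(1) by blast
  then show False using inj by (simp add: card_image)
qed

text \<open>The atoms are square roots of eigenvalues of \<open>A\<^sup>2\<close>, the masses
  squared seminorms of the components of \<open>v\<close>. For odd \<open>k\<close> one factor
  \<open>A\<close> is left over; Cauchy--Schwarz bounds its effect on each component, which gives
  the bound on \<open>h\<close>.\<close>

lemma spectral_representation:
  assumes T: "finite T" "V \<subseteq> span T" and v: "v \<in> V"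
  obtains I :: "complex set" and d w :: "complex \<Rightarrow> real" and h :: "complex \<Rightarrow> complex"
  where "finite I" "\<And>i. i \<in> I \<Longrightarrow> 0 \<le> d i" "\<And>i. i \<in> I \<Longrightarrow> 0 \<le> w i" "\<And>i. cmod (h i) \<le> 1"
    "\<And>k. B ((A ^^ k) v) v =
      (\<Sum>i\<in>I. of_real (w i * d i ^ k) * (if even k then 1 else h i))"
proof -
  \<comment> \<open>Modulo null vectors, a minimal annihilating polynomial of \<open>v\<close> has simple nonnegative roots.\<close>
  define null where "null p \<longleftrightarrow> p \<noteq> 0 \<and> B (peval p v) (peval p v) = 0" for p
  define p where "p = arg_min degree null"
  have "\<exists>p. null p" using annihilating_poly_exists[OF T v] by (force simp: null_def)
  then have p: "null p" and p_min: "\<And>q. null q \<Longrightarrow> degree p \<le> degree q"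
    using arg_min_nat_lemma[of null _ degree] by (auto simp: p_def)
  have p0: "p \<noteq> 0" using p by (simp add: null_def)
  have p_null: "B (peval p v) x = 0" for x using p null_left by (auto simp: null_def)
  define R where "R = {z. poly p z = 0}"
  have R_fin: "finite R" using p0 by (simp add: R_def poly_roots_finite)
  \<comment> \<open>Minimality of \<open>p\<close> keeps \<open>peval q v\<close> from being null,
    so modulo null vectors it is a genuine eigenvector of \<open>A\<^sup>2\<close> for
    \<open>z\<close>.\<close>
  have factor: "B (peval q v) (peval q v) \<noteq> 0 \<and> peval p v = A (A (peval q v)) - z *c peval q v"
    if q: "p = [:-z, 1:] * q" for z q
  proof -
    have "q \<noteq> 0" using p0 q by auto
    moreover from this have "degree p = Suc (degree q)" unfolding q by (subst degree_mult_eq) auto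
    ultimately have "\<not> null q" using p_min[of q] by auto
    then show ?thesis using \<open>q \<noteq> 0\<close> 
      by (simp add: null_def q peval_add peval_smult peval_diff)
  qed
  \<comment> \<open>The root is the Rayleigh quotient \<open>B (A y) (A y) / B y y\<close> of the
    eigenvector \<open>y\<close>.\<close>
  have root_real: "z = of_real (Re z) \<and> 0 \<le> Re z" if z: "z \<in> R" for z
  proof -
    obtain q where q: "p = [:-z, 1:] * q"
      using z unfolding R_def by (auto simp: poly_eq_0_iff_dvd simp del: mult_pCons_left)
    define y where "y = peval q v"
    have "y \<in> V" by (simp add: y_def peval_V v)
    have "B y y \<noteq> 0" "B (A (A y)) y = z * B y y"
      using factor[OF q] p_null[of y] by (auto simp: y_def diff_left scale_left)
    then have y0: "B y y \<noteq> 0" "B (A y) (A y) = z * B y y"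
      using A_A_self \<open>y \<in> V\<close> by auto
    then have "z = of_real (Re (B (A y) (A y)) / Re (B y y))"
      by (metis nonzero_eq_divide_eq of_real_divide self_eq_Re)
    then show ?thesis using Re_nonneg[of y] Re_nonneg[of "A y"]
      by (metis Re_complex_of_real divide_nonneg_nonneg)
  qed
  \<comment> \<open>No Jordan blocks: at a double root the non-null vector
    \<open>y = A (A x) - z *c x\<close> would satisfy \<open>B y y = B (peval p v) x = 0\<close>, by
    symmetry of \<open>A\<^sup>2\<close> and reality of \<open>z\<close>.\<close>
  have sqf: "rsquarefree p"
    unfolding rsquarefree_def
  proof (intro conjI allI p0)
    fix z
    have "Polynomial.order z p < 2"
    proof (rule ccontr)
      assume "\<not> Polynomial.order z p < 2"
      then have "[:-z, 1:] ^ 2 dvd p" using p0 by (simp add: order_divides)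
      then obtain q where "p = [:-z, 1:] ^ 2 * q" by (rule dvdE)
      then have q: "p = [:-z, 1:] * ([:-z, 1:] * q)" by (simp only: power2_eq_square mult.assoc)
      have "poly p z = 0" by (subst q) simp
      then have z: "cnj z = z" using root_real[of z] by (metis (mono_tags) R_def mem_Collect_eq complex_cnj_complex_of_real)
      define x where "x = peval q v"
      define y where "y = A (A x) - z *c x"
      have xy: "x \<in> V" "y \<in> V"
        using v V by (auto simp: x_def y_def intro: peval_V A_V subspace_diff subspace_scale)
      have y_eq: "y = peval ([:-z, 1:] * q) v"
        by (simp add: y_def x_def peval_add peval_smult peval_diff)
      have "B y y = B (peval p v) x"
        using factor[OF q] xy unfolding y_eq[symmetric]
        by (simp add: diff_left scale_left A2_sym) (simp add: y_def diff_left diff_right scale_left scale_right z A2_sym)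
      then show False using factor[OF q] p_null by (simp add: y_eq)
    qed
    then show "Polynomial.order z p = 0 \<or> Polynomial.order z p = 1" by linarith
  qed
  have deg: "degree p = card R"
  proof -
    have "p = Polynomial.smult (lead_coeff p) (\<Prod>z\<in>R. [:-z, 1:])"
      using complex_poly_decompose_rsquarefree[OF sqf] by (simp add: R_def)
    then have "degree p = degree (\<Prod>z\<in>R. [:-z, 1:])"
      using p0 by (metis degree_smult_eq leading_coeff_0_iff)
    also have "\<dots> = card R" by (subst degree_prod_eq_sum_degree) auto
    finally show ?thesis .
  qed
  have dvd: "p dvd f" if f: "\<And>z. z \<in> R \<Longrightarrow> poly f z = 0" for f
  proof (rule ccontr)
    assume "\<not> p dvd f"
    then have r0: "f mod p \<noteq> 0" by (simp add: dvd_eq_mod_eq_0)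
    then have "degree (f mod p) < degree p" using degree_mod_less[OF p0] by blast
    moreover have "R \<subseteq> {z. poly (f mod p) z = 0}"
    proof
      fix z assume "z \<in> R"
      then have "poly p z = 0" "poly f z = 0" using f by (auto simp: R_def)
      then show "z \<in> {z. poly (f mod p) z = 0}"
        by (simp flip: minus_div_mult_eq_mod)
    qed
    then have "card R \<le> degree (f mod p)"
      using card_mono[OF poly_roots_finite[OF r0]] card_poly_roots_bound[OF r0] by (meson le_trans)
    ultimately show False using deg by simp
  qed
  have vanish: "B (peval f v) x = 0" if f: "\<And>z. z \<in> R \<Longrightarrow> poly f z = 0" for f x
  proof -
    obtain g where "f = g * p" using dvd[OF f] by (metis dvdE mult.commute)
    then have f: "peval f v = peval g (peval p v)" by (simp add: peval_mult)
    have "B (peval f v) (peval f v) = B (peval p v) (peval (map_poly cnj g) (peval f v))"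
      unfolding f using v by (intro peval_adjoint peval_V)
    then show ?thesis using p_null null_left by simp
  qed
  \<comment> \<open>From here on a polynomial matters only through its values on \<open>R\<close>,
    so operator identities reduce to interpolation on the spectrum.\<close>
  have agree: "B (peval f v) x = B (peval g v) x" if "\<And>z. z \<in> R \<Longrightarrow> poly f z = poly g z" for f g x
    using vanish[of "f - g" x] that by (simp add: peval_diff diff_left)
  \<comment> \<open>\<open>L z\<close> is the Lagrange polynomial of the root \<open>z\<close>; it projects \<open>v\<close> to the eigenspace of \<open>A\<^sup>2\<close> for \<open>z\<close>.\<close>
  define L where "L z = Polynomial.smult (1 / (\<Prod>u\<in>R - {z}. z - u)) (\<Prod>u\<in>R - {z}. [:-u, 1:])" for z
  have L: "poly (L z) u = (if u = z then 1 else 0)" if "z \<in> R" "u \<in> R" for z u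
    using that R_fin by (auto simp: L_def poly_prod prod_zero_iff)
  have cnj_root: "cnj z = z" if "z \<in> R" for z
    by (metis complex_cnj_complex_of_real root_real that)
  define x where "x z = peval (L z) v" for z
  have xV: "x z \<in> V" for z by (simp add: x_def peval_V v)
  define w where "w z = Re (B (x z) (x z))" for z
  have w: "B (x z) (x z) = of_real (w z)" "0 \<le> w z" for z
    unfolding w_def using self_eq_Re Re_nonneg by auto
  define d where "d z = sqrt (Re z)" for z
  define \<kappa> where "\<kappa> z = B (A (x z)) (x z)" for z
  \<comment> \<open>Where \<open>d z * w z = 0\<close> on \<open>R\<close>, the bound
    \<open>\<kappa>_le\<close> forces \<open>\<kappa> z = 0\<close>, so the default value 0 is
    consistent with \<open>\<kappa>_eq\<close>.\<close>
  define h where "h z = (if z \<in> R \<and> d z * w z \<noteq> 0 then \<kappa> z / of_real (d z * w z) else 0)" for z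
  have d: "0 \<le> d z" "(d z)\<^sup>2 = Re z" "of_real ((d z)\<^sup>2) = z" if "z \<in> R" for z
    using root_real[OF that] by (auto simp: d_def)
  have \<kappa>_le: "cmod (\<kappa> z) \<le> d z * w z" if z: "z \<in> R" for z
  proof -
    have "B (A (x z)) (A (x z)) = B (A (A (x z))) (x z)" using A_A_self xV by simp
    also have "\<dots> = B (peval ([:0, 1:] * L z) v) (x z)" by (simp add: x_def peval_mult)
    also have "\<dots> = B (peval (Polynomial.smult z (L z)) v) (x z)"
      by (rule agree) (use L z in auto)
    also have "\<dots> = z * of_real (w z)"
      by (metis peval_smult scale_left w(1) x_def)
    finally have "Re (B (A (x z)) (A (x z))) = (d z)\<^sup>2 * w z"
      by (metis Re_complex_of_real d(3) of_real_mult z)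
    then have "(cmod (\<kappa> z))\<^sup>2 \<le> (d z * w z)\<^sup>2"
      using Cauchy_Schwarz[of "A (x z)" "x z"] by (simp add: \<kappa>_def w_def power2_eq_square mult_ac)
    then show ?thesis using d(1)[OF z] w(2) by (meson mult_nonneg_nonneg power2_le_imp_le)
  qed
  have h_le: "cmod (h z) \<le> 1" for z
    using \<kappa>_le[of z] mult_nonneg_nonneg[OF d(1)[of z] w(2)[of z]]
    by (auto simp: h_def norm_divide abs_of_nonneg divide_le_eq_1 simp flip: of_real_mult)
  have \<kappa>_eq: "\<kappa> z = of_real (w z * d z) * h z" if "z \<in> R" for z
    using \<kappa>_le[OF that] that by (auto simp: h_def mult_ac)
  have even: "B ((A ^^ (2 * j)) v) v = (\<Sum>z\<in>R. of_real (w z * d z ^ (2 * j)))" for j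
  proof -
    have "B ((A ^^ (2 * j)) v) v = B (peval (monom 1 j) v) v" by (simp add: peval_monom)
    \<comment> \<open>On \<open>R\<close> the \<open>L z\<close> are indicators, so both polynomials
      take the value \<open>u ^ j\<close> at \<open>u\<close>. Moving the conjugated factor across
      with \<open>peval_adjoint\<close> leaves \<open>B (x z) (x z)\<close>.\<close>
    also have "\<dots> = B (peval (\<Sum>z\<in>R. Polynomial.smult (z ^ j) (map_poly cnj (L z) * L z)) v) v"
    proof (rule agree)
      fix u assume "u \<in> R"
      then have "(\<Sum>z\<in>R. poly (Polynomial.smult (z ^ j) (map_poly cnj (L z) * L z)) u) =
          (\<Sum>z\<in>R. if u = z then z ^ j else 0)"
        by (intro sum.cong) (auto simp: L cnj_root)
      then show "poly (monom 1 j) u = poly (\<Sum>z\<in>R. Polynomial.smult (z ^ j) (map_poly cnj (L z) * L z)) u"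
        using \<open>u \<in> R\<close> R_fin by (simp only: poly_sum poly_monom sum.delta) simp
    qed
    also have "\<dots> = (\<Sum>z\<in>R. z ^ j * B (peval (map_poly cnj (L z)) (x z)) v)"
      by (simp add: peval_sum sum_left peval_smult scale_left peval_mult x_def)
    also have "\<dots> = (\<Sum>z\<in>R. of_real (w z * d z ^ (2 * j)))"
    proof (intro sum.cong refl)
      fix z assume z: "z \<in> R"
      have "B (peval (map_poly cnj (L z)) (x z)) v = of_real (w z)"
        using xV v by (simp add: peval_adjoint x_def[symmetric] w(1))
      moreover have "of_real (d z ^ (2 * j)) = z ^ j"
        by (metis d(3) of_real_power power_mult z)
      ultimately show "z ^ j * B (peval (map_poly cnj (L z)) (x z)) v = of_real (w z * d z ^ (2 * j))"
        by (metis mult.commute of_real_mult)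
    qed
    finally show ?thesis .
  qed
  have odd: "B ((A ^^ (Suc (2 * j))) v) v = (\<Sum>z\<in>R. of_real (w z * d z ^ Suc (2 * j)) * h z)" for j
  proof -
    have "B ((A ^^ (Suc (2 * j))) v) v = B (A (peval (monom 1 j) v)) v" by (simp add: peval_monom)
    also have "\<dots> = B (A v) (peval (monom 1 j) v)" using v by (intro A_sym peval_V)
    also have "\<dots> = cnj (B (peval (monom 1 j) v) (A v))" by (rule hermitian)
    \<comment> \<open>Here neither factor is conjugated: \<open>peval_adjoint\<close> conjugates the
      factor it moves, and \<open>A_peval\<close> absorbs this conjugation, leaving
      \<open>B (x z) (A (x z))\<close>.\<close>
    also have "B (peval (monom 1 j) v) (A v) = B (peval (\<Sum>z\<in>R. Polynomial.smult (z ^ j) (L z * L z)) v) (A v)"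
    proof (rule agree)
      fix u assume "u \<in> R"
      then have "(\<Sum>z\<in>R. poly (Polynomial.smult (z ^ j) (L z * L z)) u) =
          (\<Sum>z\<in>R. if u = z then z ^ j else 0)"
        by (intro sum.cong) (auto simp: L)
      then show "poly (monom 1 j) u = poly (\<Sum>z\<in>R. Polynomial.smult (z ^ j) (L z * L z)) u"
        using \<open>u \<in> R\<close> R_fin by (simp only: poly_sum poly_monom sum.delta) simp
    qed
    also have "\<dots> = (\<Sum>z\<in>R. z ^ j * B (peval (L z) (x z)) (A v))"
      by (simp add: peval_sum sum_left peval_smult scale_left peval_mult x_def)
    also have "cnj \<dots> = (\<Sum>z\<in>R. of_real (w z * d z ^ Suc (2 * j)) * h z)"
      unfolding cnj_sum
    proof (intro sum.cong refl)
      fix z assume z: "z \<in> R"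
      have "B (peval (L z) (x z)) (A v) = B (x z) (peval (map_poly cnj (L z)) (A v))"
        using xV v by (intro peval_adjoint A_V)
      also have "\<dots> = B (x z) (A (x z))" by (simp add: x_def A_peval)
      finally have "cnj (B (peval (L z) (x z)) (A v)) = \<kappa> z" by (metis hermitian \<kappa>_def)
      moreover have "cnj (z ^ j) = of_real (d z ^ (2 * j))"
        by (metis complex_cnj_complex_of_real d(3) of_real_power power_mult z)
      ultimately show "cnj (z ^ j * B (peval (L z) (x z)) (A v)) = of_real (w z * d z ^ Suc (2 * j)) * h z"
        by (simp add: \<kappa>_eq[OF z] mult_ac)
    qed
    finally show ?thesis .
  qed
  show thesis
  proof (rule that[of R d w h])
    fix k
    show "B ((A ^^ k) v) v = (\<Sum>i\<in>R. of_real (w i * d i ^ k) * (if even k then 1 else h i))"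
    proof (cases "even k")
      case True
      then obtain j where "k = 2 * j" by auto
      then show ?thesis using even[of j] by simp
    next
      case False
      then obtain j where "k = Suc (2 * j)" by (metis oddE Suc_eq_plus1)
      then show ?thesis using odd[of j] by simp
    qed
  qed (use R_fin d w h_le in auto)
qed

end

section \<open>Finitely atomic representations of initial moments\<close>

lemma truncated_representation:
  fixes m :: "nat \<Rightarrow> complex" and n :: nat
  defines "M \<equiv> (\<lambda>a b. if even b then m (a + b) else cnj (m (a + b)))"
  assumes herm: "\<And>k. even k \<Longrightarrow> cnj (m k) = m k"
    and psd: "\<And>N x. 0 \<le> Re (\<Sum>a\<le>N. \<Sum>b\<le>N. x a * cnj (x b) * M a b)"
  obtains I :: "complex set" and d w :: "complex \<Rightarrow> real" and h :: "complex \<Rightarrow> complex"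
  where "finite I" "\<And>i. i \<in> I \<Longrightarrow> 0 \<le> d i" "\<And>i. i \<in> I \<Longrightarrow> 0 \<le> w i" "\<And>i. cmod (h i) \<le> 1"
    "\<And>k. k \<le> n \<Longrightarrow> m k = (\<Sum>i\<in>I. of_real (w i * d i ^ k) * (if even k then 1 else h i))"
proof -
  \<comment> \<open>The sums run to \<open>Suc n\<close> because the shift of degree
    \<open>n\<close> reaches degree \<open>n + 1\<close>.\<close>
  define B where "B p q = (\<Sum>a\<le>Suc n. \<Sum>b\<le>Suc n. coeff p a * cnj (coeff q b) * M a b)" for p q
  have M_cnj: "M b a = cnj (M a b)" for a b
    using herm[of "a + b"] by (auto simp: M_def add.commute)
  \<comment> \<open>This identity is what makes the shift symmetric. Entries of opposite conjugation
    patterns agree because they then involve an even, hence real, moment.\<close>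
  have M_shift: "M (Suc a) b = M (Suc b) a" for a b
    using herm[of "Suc (a + b)"] by (auto simp: M_def add.commute)
  interpret psd_form Polynomial.smult B
  proof
    show "B q p = cnj (B p q)" for p q
      unfolding B_def cnj_sum
      by (subst sum.swap) (simp add: M_cnj[symmetric] mult_ac)
    show "0 \<le> Re (B p p)" for p
      using psd[where N = "Suc n" and x = "coeff p"] by (simp only: B_def)
  qed (simp_all add: B_def smult_add_right smult_add_left algebra_simps sum.distrib sum_distrib_left)
  define T where "T = (\<lambda>i. monom (1::complex) i) ` {..n}"
  define V where "V = {p :: complex poly. \<forall>i>n. coeff p i = 0}"
  have V: "subspace V" by (auto simp: V_def subspace_def)
  have span_V: "span T \<subseteq> V"
    by (rule span_minimal[OF _ V]) (auto simp: T_def V_def)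
  have V_span: "V \<subseteq> span T"
  proof
    fix p assume "p \<in> V"
    then have "degree p \<le> n" by (auto simp: V_def intro: degree_le)
    then have "p = (\<Sum>i\<le>n. Polynomial.smult (coeff p i) (monom 1 i))"
      using poly_as_sum_of_monoms'[of p n] by (simp add: smult_monom)
    also have "\<dots> \<in> span T"
      by (intro span_sum span_scale span_base) (auto simp: T_def)
    finally show "p \<in> span T" .
  qed
  obtain y where y: "y \<in> V" "\<And>v. v \<in> V \<Longrightarrow> B (monom 1 (Suc n) - y) v = 0"
    using projection_exists[of T "monom 1 (Suc n)"] span_V V_span by (auto simp: T_def)
  \<comment> \<open>The antilinear shift \<open>x\<^sup>a \<mapsto> x\<^sup>a\<^sup>+\<^sup>1\<close>, compressed to degree at most \<open>n\<close>: \<open>x\<^sup>n\<^sup>+\<^sup>1\<close> is replaced by its projection \<open>y\<close>.\<close>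
  define A where "A p = pCons 0 (map_poly cnj p) + Polynomial.smult (cnj (coeff p n)) (y - monom 1 (Suc n))" for p
  have cnj_add: "map_poly cnj (p + q) = map_poly cnj p + map_poly cnj q" for p q
    by (rule poly_eqI) (simp add: coeff_map_poly)
  have cnj_smult: "map_poly cnj (Polynomial.smult c p) = Polynomial.smult (cnj c) (map_poly cnj p)" for c p
    by (rule poly_eqI) (simp add: coeff_map_poly)
  \<comment> \<open>Against \<open>V\<close> the correction term vanishes, so the compressed shift
    has the same form values as the true one and its symmetry reduces to
    \<open>M_shift\<close>.\<close>
  have A_B: "B (A p) q = (\<Sum>a\<le>n. \<Sum>b\<le>n. cnj (coeff p a) * cnj (coeff q b) * M (Suc a) b)"
    if "q \<in> V" for p q
  proof -
    have "B (y - monom 1 (Suc n)) q = 0"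
      using y(2)[OF that] by (simp add: diff_left)
    then have "B (A p) q = B (pCons 0 (map_poly cnj p)) q"
      by (simp add: A_def add_left scale_left)
    also have "\<dots> = (\<Sum>a\<le>n. \<Sum>b\<le>Suc n. cnj (coeff p a) * cnj (coeff q b) * M (Suc a) b)"
      unfolding B_def by (subst sum.atMost_Suc_shift) (simp add: coeff_map_poly)
    also have "\<dots> = (\<Sum>a\<le>n. \<Sum>b\<le>n. cnj (coeff p a) * cnj (coeff q b) * M (Suc a) b)"
      using that by (simp add: V_def)
    finally show ?thesis .
  qed
  interpret antilinear_symmetric Polynomial.smult B V A
  proof
    show "subspace V" by (rule V)
    show "A x \<in> V" if "x \<in> V" for x
      using that y(1) by (auto simp: V_def A_def coeff_pCons coeff_map_poly split: nat.splits)
    show "A (x + z) = A x + A z" for x z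
      by (simp add: A_def cnj_add smult_add_left)
    show "A (Polynomial.smult c x) = Polynomial.smult (cnj c) (A x)" for c x
      by (simp add: A_def cnj_smult smult_add_right)
    show "B (A x) z = B (A z) x" if "x \<in> V" "z \<in> V" for x z
      unfolding A_B[OF that(1)] A_B[OF that(2)]
      by (subst sum.swap) (simp add: M_shift mult_ac)
  qed
  have one_V: "(1::complex poly) \<in> V" by (simp add: V_def)
  have T_fin: "finite T" by (simp add: T_def)
  obtain I :: "complex set" and d w :: "complex \<Rightarrow> real" and h where *: "finite I" "\<And>i. i \<in> I \<Longrightarrow> 0 \<le> d i" "\<And>i. i \<in> I \<Longrightarrow> 0 \<le> w i"
    "\<And>i. cmod (h i) \<le> 1"
    "\<And>k. B ((A ^^ k) 1) 1 = (\<Sum>i\<in>I. of_real (w i * d i ^ k) * (if even k then 1 else h i))"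
    by (rule spectral_representation[OF T_fin V_span one_V]) (rule that; assumption)
  \<comment> \<open>The correction in \<open>A\<close> depends on the coefficient of degree
    \<open>n\<close>, which is 0 for all powers before the last; the iterates are therefore exact up
    to degree \<open>n\<close>.\<close>
  have A_pow: "(A ^^ k) 1 = monom 1 k" if "k \<le> n" for k
    using that
  proof (induction k)
    case (Suc k)
    then show ?case by (simp add: A_def map_poly_monom monom_Suc)
  qed (simp add: one_pCons monom_0)
  have "m k = B ((A ^^ k) 1) 1" if "k \<le> n" for k
  proof -
    have "B ((A ^^ k) 1) 1 = (\<Sum>a\<le>Suc n. \<Sum>b\<le>Suc n. if b = 0 then (if a = k then m k else 0) else 0)"
      unfolding B_def A_pow[OF that]
      by (intro sum.cong refl) (auto simp: M_def)
    then show ?thesis using that by (simp add: sum.delta)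
  qed
  then show thesis using * by (intro that[of I d w h]) auto
qed

section \<open>Weak limits and moments\<close>

lemma open_approx_continuous:
  fixes U :: "'a::metric_space set"
  assumes "open U"
  obtains f :: "nat \<Rightarrow> 'a \<Rightarrow> real"
  where "\<And>n. continuous_on UNIV (f n)" "\<And>n x. 0 \<le> f n x" "\<And>n x. f n x \<le> 1"
    "\<And>x. (\<lambda>n. f n x) \<longlonglongrightarrow> indicator U x"
\<comment> \<open>The distance \<open>infdist\<close> to an empty complement is 0, so the whole
  space is treated apart.\<close>
proof (cases "U = UNIV")
  case True
  then show thesis by (intro that[of "\<lambda>_ _. 1"]) auto
next
  case False
  define f where "f n x = min 1 (real n * infdist x (- U))" for n x
  have "(\<lambda>n. f n x) \<longlonglongrightarrow> indicator U x" for x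
  proof (cases "x \<in> U")
    case True
    have "infdist x (- U) > 0"
      using False True assms by (intro infdist_pos_not_in_closed) auto
    then obtain N where N: "1 < real N * infdist x (- U)"
      using ex_less_of_nat_mult by blast
    have "\<forall>\<^sub>F n in sequentially. f n x = 1"
      using eventually_ge_at_top[of N]
    proof eventually_elim
      case (elim n)
      then have "real N * infdist x (- U) \<le> real n * infdist x (- U)"
        by (intro mult_right_mono) (auto simp: infdist_nonneg)
      then show ?case using N by (simp add: f_def)
    qed
    then show ?thesis using True by (simp add: tendsto_eventually)
  next
    case False
    then show ?thesis by (simp add: f_def)
  qed
  then show thesis
    by (intro that[of f]) (auto simp: f_def infdist_nonneg intro!: continuous_intros)
qed

text \<open>Continuous functions increase to the indicator of an open set, which gives the
  inequality there; outer regularity of \<open>N\<close> extends it to Borel sets. Test functions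
  with values in [0,1] are those that weak convergence controls.\<close>

lemma measure_le_if_integral_le:
  fixes M N :: "'a::{second_countable_topology,complete_space} measure"
  assumes "finite_measure M" "finite_measure N" "sets M = sets borel" "sets N = sets borel"
    and le: "\<And>f :: 'a \<Rightarrow> real. continuous_on UNIV f \<Longrightarrow> (\<And>x. 0 \<le> f x) \<Longrightarrow> (\<And>x. f x \<le> 1) \<Longrightarrow>
      integral\<^sup>L M f \<le> integral\<^sup>L N f"
    and E: "E \<in> sets borel"
  shows "emeasure M E \<le> emeasure N E"
proof -
  interpret M: finite_measure M by fact
  interpret N: finite_measure N by fact
  have space: "space M = UNIV" "space N = UNIV"
    using assms(3,4) by (auto dest: sets_eq_imp_space_eq)
  have open_le: "emeasure M U \<le> emeasure N U" if U: "open U" for U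
  proof -
    obtain f where f: "\<And>n. continuous_on UNIV (f n)" "\<And>n x. 0 \<le> f n x" "\<And>n x. f n x \<le> (1::real)"
      "\<And>x. (\<lambda>n. f n x) \<longlonglongrightarrow> indicator U x"
      using open_approx_continuous[OF U] by metis
    have lim: "(\<lambda>n. integral\<^sup>L K (f n)) \<longlonglongrightarrow> measure K U"
      if K: "finite_measure K" "sets K = sets borel" "space K = UNIV" for K
    proof -
      interpret finite_measure K by fact
      have [measurable]: "f n \<in> borel_measurable K" for n
        using f(1)[of n] K(2) by (simp add: borel_measurable_continuous_onI cong: measurable_cong_sets)
      have [measurable]: "U \<in> sets K" using U K(2) by simp
      have "(\<lambda>n. integral\<^sup>L K (f n)) \<longlonglongrightarrow> integral\<^sup>L K (indicator U)"
        using f by (intro integral_dominated_convergence[where w = "\<lambda>_. 1"]) auto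
      then show ?thesis using K by simp
    qed
    have "measure M U \<le> measure N U"
      by (rule LIMSEQ_le[OF lim lim]) (use assms space f le in auto)
    then show ?thesis by (simp add: M.emeasure_eq_measure N.emeasure_eq_measure)
  qed
  have "emeasure N E = (INF U \<in> {U. E \<subseteq> U \<and> open U}. emeasure N U)"
    using assms by (intro outer_regular) auto
  also have "\<dots> \<ge> emeasure M E"
  proof (rule INF_greatest)
    fix U assume "U \<in> {U. E \<subseteq> U \<and> open U}"
    then have "emeasure M E \<le> emeasure M U" "emeasure M U \<le> emeasure N U"
      using assms open_le by (auto intro!: emeasure_mono)
    then show "emeasure M E \<le> emeasure N U" by (rule order_trans)
  qed
  finally show ?thesis .
qed

text \<open>The measures with densities the positive and the negative part of \<open>k\<close> are
  compared by the preceding lemma. On \<open>{x. k x < 0}\<close> the first has no mass, hence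
  neither has the second.\<close>

lemma AE_nonneg_if_integral_continuous_nonneg:
  fixes M :: "'a::{second_countable_topology,complete_space} measure" and k :: "'a \<Rightarrow> real"
  assumes "sets M = sets borel" and k: "integrable M k"
    and nonneg: "\<And>f :: 'a \<Rightarrow> real. continuous_on UNIV f \<Longrightarrow> (\<And>x. 0 \<le> f x) \<Longrightarrow> (\<And>x. f x \<le> 1) \<Longrightarrow>
      0 \<le> (\<integral>x. f x * k x \<partial>M)"
  shows "AE x in M. 0 \<le> k x"
proof -
  note [measurable] = borel_measurable_integrable[OF k]
  define P where "P = density M (\<lambda>x. ennreal (max 0 (k x)))"
  define N where "N = density M (\<lambda>x. ennreal (max 0 (- k x)))"
  have int: "integrable M (\<lambda>x. max 0 (k x))" "integrable M (\<lambda>x. max 0 (- k x))"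
    using k by auto
  have fin: "finite_measure P" "finite_measure N"
    using int by (auto intro!: finite_measureI simp: P_def N_def emeasure_density nn_integral_eq_integral
        cong: nn_integral_cong_simp)
  have le: "emeasure N E \<le> emeasure P E" if "E \<in> sets borel" for E
  proof (rule measure_le_if_integral_le[OF fin(2,1) _ _ _ that])
    fix f :: "'a \<Rightarrow> real"
    assume f: "continuous_on UNIV f" "\<And>x. 0 \<le> f x" "\<And>x. f x \<le> 1"
    have [measurable]: "f \<in> borel_measurable M"
      using f(1) assms(1) by (simp add: borel_measurable_continuous_onI cong: measurable_cong_sets)
    have i: "integrable M (\<lambda>x. max 0 (k x) * f x)" "integrable M (\<lambda>x. max 0 (- k x) * f x)"
      using f by (intro Bochner_Integration.integrable_bound[OF int(1)]
          Bochner_Integration.integrable_bound[OF int(2)]; auto simp: abs_mult mult_left_le)+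
    have "integral\<^sup>L P f - integral\<^sup>L N f = (\<integral>x. max 0 (k x) * f x - max 0 (- k x) * f x \<partial>M)"
      using i unfolding P_def N_def by (simp add: integral_density)
    also have "\<dots> = (\<integral>x. f x * k x \<partial>M)"
      by (intro Bochner_Integration.integral_cong) (auto simp: max_def algebra_simps)
    finally show "integral\<^sup>L N f \<le> integral\<^sup>L P f" using nonneg[OF f] by simp
  qed (simp_all add: P_def N_def assms(1))
  define E where "E = {x \<in> space M. k x < 0}"
  have E: "E \<in> sets M" by (simp add: E_def)
  have "emeasure P E = 0"
    using E by (auto simp: P_def emeasure_density E_def max_def nn_integral_0_iff_AE intro!: AE_I2)
  then have "emeasure N E = 0" using le[of E] E assms(1) by simp
  then have "AE x in M. ennreal (max 0 (- k x)) * indicator E x = 0"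
    using E by (simp add: N_def emeasure_density nn_integral_0_iff_AE)
  then show ?thesis
    using AE_space by eventually_elim (auto simp: E_def ennreal_eq_0_iff indicator_def split: if_splits)
qed

section \<open>Truncated powers and the moments of weak limits\<close>

definition truncate :: "real \<Rightarrow> real \<Rightarrow> real" where
  "truncate R x = max (- R) (min R x)"

lemma truncate_bound: "0 \<le> R \<Longrightarrow> \<bar>truncate R x\<bar> \<le> R"
  by (auto simp: truncate_def)

lemma truncate_power_bound: "0 \<le> R \<Longrightarrow> \<bar>truncate R x ^ k\<bar> \<le> R ^ k"
  by (simp add: power_abs power_mono truncate_bound)

lemma abs_truncate_le: "0 \<le> R \<Longrightarrow> \<bar>truncate R x\<bar> \<le> \<bar>x\<bar>"
  by (auto simp: truncate_def)

lemma truncate_eq: "\<bar>x\<bar> \<le> R \<Longrightarrow> truncate R x = x"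
  by (auto simp: truncate_def)

lemma isCont_truncate: "isCont (\<lambda>x. truncate R x ^ k) x"
  unfolding truncate_def by (intro continuous_intros)

lemma measurable_truncate [measurable]: "truncate R \<in> borel_measurable borel"
  unfolding truncate_def by measurable

text \<open>Only \<bar>x\<bar> > R contributes, and there an additional factor \<bar>x\<bar> / R
  exceeds 1. The exponent is raised to an even one so that the bound integrates to a moment.\<close>

lemma truncate_power_error:
  assumes "1 \<le> R"
  shows "\<bar>x ^ k - truncate R x ^ k\<bar> \<le> 2 / R * x ^ (2 * k + 2)"
proof (cases "\<bar>x\<bar> \<le> R")
  case True
  have "0 \<le> x ^ (2 * k + 2)" by (rule zero_le_even_power) simp
  then have "0 \<le> 2 / R * x ^ (2 * k + 2)" using assms by (intro mult_nonneg_nonneg) auto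
  then show ?thesis using True by (simp add: truncate_eq)
next
  case False
  have "\<bar>x ^ k - truncate R x ^ k\<bar> \<le> \<bar>x\<bar> ^ k + \<bar>truncate R x\<bar> ^ k"
    by (metis abs_triangle_ineq4 power_abs)
  also have "\<dots> \<le> 2 * \<bar>x\<bar> ^ k"
    using assms power_mono[OF abs_truncate_le[of R x], of k] by simp
  also have "\<dots> \<le> 2 / R * \<bar>x\<bar> ^ (k + 1)"
    using False assms by (simp add: field_simps mult_right_mono)
  also have "\<dots> \<le> 2 / R * \<bar>x\<bar> ^ (2 * k + 2)"
    using False assms by (intro mult_left_mono power_increasing) auto
  also have "\<bar>x\<bar> ^ (2 * k + 2) = x ^ (2 * k + 2)" by (simp add: power_even_abs)
  finally show ?thesis .
qed

text \<open>Weak convergence sees only bounded continuous functions, so powers are truncated at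
  \<open>R\<close>. The truncation error is at most \<open>2 / R\<close> times a fixed even moment,
  uniformly along the sequence, and \<open>R\<close> then tends to infinity.\<close>

lemma weak_limit_moments:
  fixes \<mu> :: "nat \<Rightarrow> real measure"
  assumes \<mu>: "\<And>n. real_distribution (\<mu> n)" and M: "real_distribution M" 
    and weak: "weak_conv_m \<mu> M"
    and int: "\<And>n k. integrable (\<mu> n) (\<lambda>x. x ^ k)"
    and mom: "\<And>k. \<forall>\<^sub>F n in sequentially. (\<integral>x. x ^ k \<partial>\<mu> n) = c k"
  shows "integrable M (\<lambda>x. x ^ k)" "(\<integral>x. x ^ k \<partial>M) = c k"
proof -
  interpret M: real_distribution M by fact
  interpret \<mu>: real_distribution "\<mu> n" for n by fact
  have conv: "(\<lambda>n. \<integral>x. truncate R x ^ k \<partial>\<mu> n) \<longlonglongrightarrow> (\<integral>x. truncate R x ^ k \<partial>M)" if "0 \<le> R" for R k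
    using truncate_power_bound[OF that]
    by (intro weak_conv_imp_integral_bdd_continuous_conv[OF \<mu> M weak, where B = "R ^ k"])
      (auto simp: isCont_truncate)
  have trunc_int: "integrable M (\<lambda>x. truncate R x ^ k)" "integrable (\<mu> n) (\<lambda>x. truncate R x ^ k)"
    if "0 \<le> R" for R k n
    using truncate_power_bound[OF that]
    by (auto intro!: M.integrable_const_bound[where B = "R ^ k"] \<mu>.integrable_const_bound[where B = "R ^ k"])
  \<comment> \<open>Truncation decreases even powers, so the truncated integrals are bounded by
    \<open>c (2 * k)\<close> along the sequence and in the limit; Fatou's lemma removes the
    truncation.\<close>
  have even_bound: "(\<integral>\<^sup>+x. ennreal (x ^ (2 * k)) \<partial>M) \<le> ennreal (c (2 * k))" for k
  proof -
    have "(\<integral>x. truncate (real R) x ^ (2 * k) \<partial>M) \<le> c (2 * k)" for R :: nat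
    proof (rule LIMSEQ_le_const2[OF conv])
      have "\<forall>\<^sub>F n in sequentially. (\<integral>x. truncate (real R) x ^ (2 * k) \<partial>\<mu> n) \<le> c (2 * k)"
        using mom[of "2 * k"]
      proof eventually_elim
        case (elim n)
        have "truncate (real R) x ^ (2 * k) \<le> x ^ (2 * k)" for x
          using power_mono[OF abs_truncate_le[of "real R" x], of "2 * k"] by (simp add: power_even_abs)
        then show ?case
          unfolding elim[symmetric] using int trunc_int by (intro integral_mono) auto
      qed
      then show "\<exists>N. \<forall>n\<ge>N. (\<integral>x. truncate (real R) x ^ (2 * k) \<partial>\<mu> n) \<le> c (2 * k)"
        by (simp add: eventually_sequentially)
    qed simp
    then have le: "(\<integral>\<^sup>+x. ennreal (truncate (real R) x ^ (2 * k)) \<partial>M) \<le> ennreal (c (2 * k))" for R :: nat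
      using trunc_int by (subst nn_integral_eq_integral) (auto intro!: ennreal_leI)
    have "(\<integral>\<^sup>+x. ennreal (x ^ (2 * k)) \<partial>M)
        = (\<integral>\<^sup>+x. liminf (\<lambda>R. ennreal (truncate (real R) x ^ (2 * k))) \<partial>M)"
    proof (intro nn_integral_cong)
      fix x :: real
      have "\<forall>\<^sub>F R in sequentially. truncate (real R) x = x"
        using eventually_ge_at_top[of "nat \<lceil>\<bar>x\<bar>\<rceil>"]
        by eventually_elim (auto intro!: truncate_eq simp: nat_le_iff ceiling_le_iff)
      then have "\<forall>\<^sub>F R in sequentially. ennreal (truncate (real R) x ^ (2 * k)) = ennreal (x ^ (2 * k))"
        by eventually_elim simp
      then have "(\<lambda>R. ennreal (truncate (real R) x ^ (2 * k))) \<longlonglongrightarrow> ennreal (x ^ (2 * k))"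
        by (rule tendsto_eventually)
      then show "ennreal (x ^ (2 * k)) = liminf (\<lambda>R. ennreal (truncate (real R) x ^ (2 * k)))"
        by (metis lim_imp_Liminf sequentially_bot)
    qed
    also have "\<dots> \<le> liminf (\<lambda>R. \<integral>\<^sup>+x. ennreal (truncate (real R) x ^ (2 * k)) \<partial>M)"
      by (intro nn_integral_liminf) measurable
    also have "\<dots> \<le> ennreal (c (2 * k))"
      using le by (intro Liminf_le) auto
    finally show ?thesis .
  qed
  have even_int: "integrable M (\<lambda>x. x ^ (2 * k))" for k
    using le_less_trans[OF even_bound[of k] ennreal_less_top] by (intro integrableI_nonneg) auto
  have c_nonneg: "0 \<le> c (2 * k)" for k
  proof -
    obtain n where "(\<integral>x. x ^ (2 * k) \<partial>\<mu> n) = c (2 * k)"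
      using mom[of "2 * k"] by (auto simp: eventually_sequentially)
    moreover have "0 \<le> (\<integral>x. x ^ (2 * k) \<partial>\<mu> n)" by (intro integral_nonneg_AE) auto
    ultimately show ?thesis by simp
  qed
  have even_le: "(\<integral>x. x ^ (2 * k) \<partial>M) \<le> c (2 * k)" for k
    using even_bound[of k] even_int[of k] c_nonneg[of k] by (subst (asm) nn_integral_eq_integral) auto
  show int_M: "integrable M (\<lambda>x. x ^ k)" for k
  proof (rule Bochner_Integration.integrable_bound)
    show "integrable M (\<lambda>x. 1 + x ^ (2 * k))" using even_int by simp
    have "\<bar>x ^ k\<bar> \<le> 1 + x ^ (2 * k)" for x :: real
    proof -
      have "0 \<le> (\<bar>x ^ k\<bar> - 1)\<^sup>2" by simp
      moreover have "x ^ (2 * k) = \<bar>x ^ k\<bar>\<^sup>2" by (simp add: power_mult[symmetric] mult.commute)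
      ultimately have "2 * \<bar>x ^ k\<bar> \<le> 1 + x ^ (2 * k)" by (simp add: power2_diff del: power2_abs)
      then show ?thesis using abs_ge_zero[of "x ^ k"] by linarith
    qed
    then show "AE x in M. norm (x ^ k) \<le> norm (1 + x ^ (2 * k))" by (intro AE_I2) (smt (verit) real_norm_def)
  qed simp
  show "(\<integral>x. x ^ k \<partial>M) = c k"
  proof -
    define e where "e = 2 * k + 2"
    have e: "e = 2 * (k + 1)" by (simp add: e_def)
    define C where "C = c e"
    have err: "\<bar>(\<integral>x. x ^ k \<partial>K) - (\<integral>x. truncate R x ^ k \<partial>K)\<bar> \<le> 2 / R * C"
      if R: "1 \<le> R" and K: "\<And>k. integrable K (\<lambda>x. x ^ k)" "integrable K (\<lambda>x. truncate R x ^ k)"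
        "(\<integral>x. x ^ e \<partial>K) \<le> C" for R K
    proof -
      have "\<bar>(\<integral>x. x ^ k \<partial>K) - (\<integral>x. truncate R x ^ k \<partial>K)\<bar> = \<bar>\<integral>x. x ^ k - truncate R x ^ k \<partial>K\<bar>"
        using K by simp
      also have "\<dots> \<le> (\<integral>x. \<bar>x ^ k - truncate R x ^ k\<bar> \<partial>K)" by (rule integral_abs_bound)
      also have "\<dots> \<le> (\<integral>x. 2 / R * x ^ e \<partial>K)"
        using K truncate_power_error[OF R, of _ k, folded e_def] by (intro integral_mono) auto
      also have "\<dots> \<le> 2 / R * C" using K(3) R by (simp add: divide_right_mono)
      finally show ?thesis .
    qed
    have bound: "\<bar>(\<integral>x. x ^ k \<partial>M) - c k\<bar> \<le> 4 / R * C" if R: "1 \<le> R" for R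
    proof -
      have "\<forall>\<^sub>F n in sequentially. \<bar>c k - (\<integral>x. truncate R x ^ k \<partial>\<mu> n)\<bar> \<le> 2 / R * C"
        using mom[of k] mom[of e]
      proof eventually_elim
        case (elim n)
        then show ?case using err[of R "\<mu> n"] R int trunc_int by (simp add: C_def)
      qed
      then have "\<bar>c k - (\<integral>x. truncate R x ^ k \<partial>M)\<bar> \<le> 2 / R * C"
        using R by (intro tendsto_upperbound[OF tendsto_rabs[OF tendsto_diff[OF tendsto_const conv]]]) auto
      moreover have "\<bar>(\<integral>x. x ^ k \<partial>M) - (\<integral>x. truncate R x ^ k \<partial>M)\<bar> \<le> 2 / R * C"
        using err[of R M] R int_M trunc_int even_le[of "k + 1"] by (simp add: C_def e)
      ultimately show ?thesis by simp
    qed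
    have "((\<lambda>R. 4 / R * C) \<longlongrightarrow> 0) at_top"
      by (intro tendsto_mult_left_zero tendsto_divide_0[OF tendsto_const] filterlim_at_top_imp_at_infinity filterlim_ident)
    then have "\<bar>(\<integral>x. x ^ k \<partial>M) - c k\<bar> \<le> 0"
      using bound by (intro tendsto_lowerbound[of _ 0 at_top]) (auto intro: eventually_at_top_linorderI)
    then show ?thesis by simp
  qed
qed

text \<open>Each atom \<open>d i\<close> of mass \<open>w i\<close> is split between \<open>d i\<close> and \<open>- d i\<close> so that odd functions see the
  weight \<open>w i * g i\<close>. This encodes a signed density by a probability measure, to which Helly's
  theorem applies.\<close>

definition two_sided :: "'i set \<Rightarrow> ('i \<Rightarrow> real) \<Rightarrow> ('i \<Rightarrow> real) \<Rightarrow> ('i \<Rightarrow> real) \<Rightarrow> real measure" where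
  "two_sided I d w g =
    distr (point_measure (I \<times> {- 1, 1}) (\<lambda>(i, s). ennreal (w i * (1 + s * g i) / 2)))
      borel (\<lambda>(i, s). s * d i)"

lemma two_sided:
  assumes I: "finite I" and w: "\<And>i. i \<in> I \<Longrightarrow> 0 \<le> w i" and g: "\<And>i. \<bar>g i\<bar> \<le> 1"
  shows integrable_two_sided: "f \<in> borel_measurable borel \<Longrightarrow> integrable (two_sided I d w g) (f :: real \<Rightarrow> real)"
    and integral_two_sided: "f \<in> borel_measurable borel \<Longrightarrow> integral\<^sup>L (two_sided I d w g) f =
      (\<Sum>i\<in>I. w i * ((f (d i) + f (- d i)) / 2 + g i * ((f (d i) - f (- d i)) / 2)))"
    and real_distribution_two_sided: "(\<Sum>i\<in>I. w i) = 1 \<Longrightarrow> real_distribution (two_sided I d w g)"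
proof -
  define a where "a = (\<lambda>(i, s). w i * (1 + s * g i) / 2)"
  define P where "P = point_measure (I \<times> {- 1, 1 :: real}) (\<lambda>p. ennreal (a p))"
  have T: "two_sided I d w g = distr P borel (\<lambda>(i, s). s * d i)"
    by (simp add: two_sided_def P_def a_def case_prod_unfold)
  have fin: "finite (I \<times> {- 1, 1 :: real})" using I by simp
  have a: "0 \<le> a p" if "p \<in> I \<times> {- 1, 1}" for p
    using that w[of "fst p"] g[of "fst p"] by (auto simp: a_def abs_le_iff)
  have [measurable]: "(\<lambda>(i, s). s * d i) \<in> borel_measurable P" by (simp add: P_def)
  {
    fix f :: "real \<Rightarrow> real" assume [measurable]: "f \<in> borel_measurable borel"
    show "integrable (two_sided I d w g) f"
      using integrable_point_measure_finite[OF fin, where f = a and g = "\<lambda>(i, s). f (s * d i)"]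
      by (simp add: T integrable_distr_eq P_def case_prod_unfold)
    have "integral\<^sup>L (two_sided I d w g) f = (\<Sum>p\<in>I \<times> {- 1, 1}. a p * f (snd p * d (fst p)))"
      using lebesgue_integral_point_measure_finite[OF fin a, where g = "\<lambda>(i, s). f (s * d i)"]
      by (simp add: T integral_distr P_def case_prod_unfold)
    also have "\<dots> = (\<Sum>i\<in>I. \<Sum>s\<in>{- 1, 1}. a (i, s) * f (s * d i))"
      unfolding sum.cartesian_product by (simp add: case_prod_unfold)
    also have "\<dots> = (\<Sum>i\<in>I. w i * ((f (d i) + f (- d i)) / 2 + g i * ((f (d i) - f (- d i)) / 2)))"
      by (intro sum.cong refl) (simp add: a_def field_simps)
    finally show "integral\<^sup>L (two_sided I d w g) f =
      (\<Sum>i\<in>I. w i * ((f (d i) + f (- d i)) / 2 + g i * ((f (d i) - f (- d i)) / 2)))" .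
  }
  assume 1: "(\<Sum>i\<in>I. w i) = 1"
  have "(\<Sum>p\<in>I \<times> {- 1, 1}. a p) = (\<Sum>i\<in>I. \<Sum>s\<in>{- 1, 1}. a (i, s))"
    unfolding sum.cartesian_product by simp
  also have "\<dots> = (\<Sum>i\<in>I. w i)" by (intro sum.cong refl) (simp add: a_def field_simps)
  finally have "(\<Sum>p\<in>I \<times> {- 1, 1}. ennreal (a p)) = 1" using a 1 by (subst sum_ennreal) auto
  then have "prob_space P"
    using fin by (intro prob_spaceI) (simp add: P_def space_point_measure emeasure_point_measure_finite)
  then show "real_distribution (two_sided I d w g)"
    unfolding T by (intro real_distribution.intro prob_space.prob_space_distr) (auto simp: real_distribution_axioms_def)
qed

section \<open>Tightness, subsequences and densities of limits\<close>

lemma tight_if_second_moment: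
  assumes \<mu>: "\<And>n. real_distribution (\<mu> n)" and int: "\<And>n. integrable (\<mu> n) (\<lambda>x. x\<^sup>2)"
    and c: "\<And>n. (\<integral>x. x\<^sup>2 \<partial>\<mu> n) \<le> c"
  shows "tight \<mu>"
  unfolding tight_def
proof (intro conjI allI impI \<mu>)
  fix \<epsilon> :: real assume \<epsilon>: "\<epsilon> > 0"
  \<comment> \<open>Chosen so that \<open>c < \<epsilon> * a\<close> and \<open>a \<ge> 1\<close>,
    whence Chebyshev's bound \<open>c / a\<^sup>2\<close> is below
    \<open>\<epsilon>\<close>.\<close>
  define a where "a = 1 + 2 * \<bar>c\<bar> / \<epsilon>"
  have a: "a \<ge> 1" using \<epsilon> by (simp add: a_def)
  have "c < \<epsilon> * a" using \<epsilon> by (simp add: a_def algebra_simps)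
  also have "\<dots> \<le> \<epsilon> * a\<^sup>2" using a \<epsilon> by (simp add: power2_eq_square)
  finally have ca: "c / a\<^sup>2 < \<epsilon>" using a by (simp add: field_simps)
  have "measure (\<mu> n) {- a<..a} > 1 - \<epsilon>" for n
  proof -
    interpret real_distribution "\<mu> n" by fact
    have "prob {x \<in> space (\<mu> n). \<bar>x\<bar> \<ge> a} \<le> (\<integral>x. x\<^sup>2 \<partial>\<mu> n) / a\<^sup>2"
      using a int by (intro second_moment_method) auto
    also have "\<dots> \<le> c / a\<^sup>2" using c by (simp add: divide_right_mono)
    finally have 1: "prob {x. \<bar>x\<bar> \<ge> a} < \<epsilon>" using ca by simp
    have "1 = prob ({- a<..a} \<union> {x. \<bar>x\<bar> \<ge> a})"
    proof -
      have "{- a<..a} \<union> {x. \<bar>x\<bar> \<ge> a} = space (\<mu> n)" by auto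
      then show ?thesis by (metis prob_space)
    qed
    also have "\<dots> \<le> prob {- a<..a} + prob {x. \<bar>x\<bar> \<ge> a}"
      by (rule measure_Un_le) auto
    finally show ?thesis using 1 by simp
  qed
  then show "\<exists>a b. a < b \<and> (\<forall>n. 1 - \<epsilon> < measure (\<mu> n) {a<..b})"
    using a by (intro exI[of _ "- a"] exI[of _ a]) auto
qed

lemma weak_conv_m_subseq:
  assumes "weak_conv_m \<mu> M" "strict_mono r"
  shows "weak_conv_m (\<mu> \<circ> r) M"
  unfolding weak_conv_m_def weak_conv_def
proof (intro allI impI)
  fix x assume "isCont (cdf M) x"
  then have "(\<lambda>n. cdf (\<mu> n) x) \<longlonglongrightarrow> cdf M x"
    using assms(1) by (simp add: weak_conv_m_def weak_conv_def)
  from LIMSEQ_subseq_LIMSEQ[OF this assms(2)]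
  show "(\<lambda>n. cdf ((\<mu> \<circ> r) n) x) \<longlonglongrightarrow> cdf M x" by (simp add: o_def)
qed

text \<open>The test functions show that \<open>C\<close> times \<open>M\<close> dominates
  \<open>N\<close> on Borel sets, so Radon--Nikodym applies. Finiteness of \<open>N\<close> makes
  the density finite almost everywhere, hence replaceable by a real one.\<close>

lemma density_if_integral_le:
  fixes M N :: "'a::{second_countable_topology,complete_space} measure"
  assumes "finite_measure M" "finite_measure N" "sets M = sets borel" "sets N = sets borel"
    and C: "0 \<le> C"
    and le: "\<And>f :: 'a \<Rightarrow> real. continuous_on UNIV f \<Longrightarrow> (\<And>x. 0 \<le> f x) \<Longrightarrow> (\<And>x. f x \<le> 1) \<Longrightarrow>
      integral\<^sup>L N f \<le> C * integral\<^sup>L M f"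
  obtains g :: "'a \<Rightarrow> real" where "g \<in> borel_measurable borel" "\<And>x. 0 \<le> g x" "N = density M g"
proof -
  interpret M: finite_measure M by fact
  interpret N: finite_measure N by fact
  define K where "K = density M (\<lambda>_. ennreal C)"
  have K: "emeasure K E = ennreal C * emeasure M E" if "E \<in> sets M" for E
    using that by (simp add: K_def emeasure_density_const)
  have K_fin: "finite_measure K"
    by (rule finite_measureI) (simp add: K_def emeasure_density_const ennreal_mult_eq_top_iff)
  have "emeasure N E \<le> emeasure K E" if E: "E \<in> sets borel" for E
  proof (rule measure_le_if_integral_le[OF assms(2) K_fin _ _ _ E])
    fix f :: "'a \<Rightarrow> real"
    assume f: "continuous_on UNIV f" "\<And>x. 0 \<le> f x" "\<And>x. f x \<le> 1"
    have [measurable]: "f \<in> borel_measurable M"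
      using f(1) assms(3) by (simp add: borel_measurable_continuous_onI cong: measurable_cong_sets)
    have "integral\<^sup>L K f = C * integral\<^sup>L M f"
      unfolding K_def using C by (subst integral_density) auto
    then show "integral\<^sup>L N f \<le> integral\<^sup>L K f" using le[OF f] by simp
  qed (simp_all add: K_def assms)
  then have "absolutely_continuous M N"
    using assms(3,4) K by (auto simp: absolutely_continuous_def null_sets_def) (metis le_zero_eq mult_zero_right)
  then obtain f where f: "f \<in> borel_measurable M" "density M f = N"
    using M.Radon_Nikodym[of N] assms(3,4) by auto
  have "(\<integral>\<^sup>+x. f x \<partial>M) = emeasure N (space M)"
    using f by (simp add: f(2)[symmetric] emeasure_density cong: nn_integral_cong_simp)
  also have "\<dots> \<noteq> \<infinity>" by simp
  finally have fin: "AE x in M. f x \<noteq> \<infinity>" using f(1) by (intro nn_integral_noteq_infinite)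
  have "N = density M (\<lambda>x. ennreal (enn2real (f x)))"
    unfolding f(2)[symmetric] using fin f(1)
    by (intro density_cong) (auto elim!: eventually_mono simp: less_top)
  moreover have "(\<lambda>x. enn2real (f x)) \<in> borel_measurable borel"
    using f(1) assms(3) by (simp cong: measurable_cong_sets)
  ultimately show thesis by (intro that[of "\<lambda>x. enn2real (f x)"]) auto
qed

text \<open>\<open>S\<close> lives on the whole line, with \<open>x\<close> and \<open>- x\<close>
  both standing for the radius \<bar>x\<bar>. Oddness of \<open>H\<close> makes
  \<open>x ^ k * H x\<close> even for odd \<open>k\<close>, so it is a function of the
  radius.\<close>

lemma limit_representation:
  fixes m :: "nat \<Rightarrow> complex"
  assumes m0: "m 0 = 1"
    and rep: "\<And>n. \<exists>(I :: 'i set) d w h. finite I \<and> (\<forall>i\<in>I. 0 \<le> w i) \<and> (\<forall>i. cmod (h i) \<le> 1) \<and>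
      (\<forall>k\<le>n. m k = (\<Sum>i\<in>I. of_real (w i * d i ^ k) * (if even k then 1 else h i)))"
  obtains S :: "real measure" and H :: "real \<Rightarrow> complex"
  where "real_distribution S" "distr S borel uminus = S" "\<And>k. integrable S (\<lambda>x. x ^ k)"
    "H \<in> borel_measurable borel" "\<And>x. cmod (H x) \<le> 1" "\<And>x. H (- x) = - H x"
    "\<And>k. m k = (\<integral>x. of_real (x ^ k) * (if even k then 1 else H x) \<partial>S)"
proof -
  define R where "R n I d w h \<longleftrightarrow> finite I \<and> (\<forall>i\<in>I. 0 \<le> w i) \<and> (\<forall>i. cmod (h i) \<le> 1) \<and>
      (\<forall>k\<le>n. m k = (\<Sum>i\<in>I. of_real (w i * d i ^ k) * (if even k then 1 else h i)))"
    for n and I :: "'i set" and d w h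
  \<comment> \<open>Two additional degrees make the second moment, needed for tightness, correct for
    every \<open>n\<close>, including 0.\<close>
  have "\<forall>n. \<exists>I d w h. R (Suc (Suc n)) I d w h" using rep unfolding R_def by blast
  then obtain I d w h where "\<And>n. R (Suc (Suc n)) (I n) (d n) (w n) (h n)" by metis
  then have I: "\<And>n. finite (I n)" and w: "\<And>n i. i \<in> I n \<Longrightarrow> 0 \<le> w n i" and h: "\<And>n i. cmod (h n i) \<le> 1"
    and m: "\<And>n k. k \<le> Suc (Suc n) \<Longrightarrow>
      m k = (\<Sum>i\<in>I n. of_real (w n i * d n i ^ k) * (if even k then 1 else h n i))"
    by (auto simp: R_def)
  \<comment> \<open>The complex density is probed through real ones: \<open>q = 0\<close> gives the
    symmetric law, \<open>q = 1\<close> the real part of \<open>h\<close> and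
    \<open>q = - \<i>\<close> its imaginary part.\<close>
  define \<mu> where "\<mu> q n = two_sided (I n) (d n) (w n) (\<lambda>i. Re (q * h n i))" for q n
  define c where "c q k = (if even k then Re (m k) else Re (q * m k))" for q k
  have qh: "\<bar>Re (q * h n i)\<bar> \<le> 1" if "cmod q \<le> 1" for q n i
    using that h[of n i] abs_Re_le_cmod[of "q * h n i"] mult_mono[of "cmod q" 1 "cmod (h n i)" 1]
    by (simp add: norm_mult)
  have w1: "(\<Sum>i\<in>I n. w n i) = 1" for n
  proof -
    have "of_real (\<Sum>i\<in>I n. w n i) = (1 :: complex)" using m[of 0 n] m0 by simp
    then show ?thesis by (simp only: of_real_eq_1_iff)
  qed
  have dist: "real_distribution (\<mu> q n)" if "cmod q \<le> 1" for q n
    unfolding \<mu>_def using I w qh[OF that] w1 by (intro real_distribution_two_sided) auto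
  have int: "integrable (\<mu> q n) f" if "cmod q \<le> 1" "f \<in> borel_measurable borel"
    for q n and f :: "real \<Rightarrow> real"
    unfolding \<mu>_def using I w qh[OF that(1)] that(2) by (intro integrable_two_sided) auto
  have integral: "integral\<^sup>L (\<mu> q n) f = (\<Sum>i\<in>I n. w n i *
      ((f (d n i) + f (- d n i)) / 2 + Re (q * h n i) * ((f (d n i) - f (- d n i)) / 2)))"
    if "cmod q \<le> 1" "f \<in> borel_measurable borel" for q n f
    unfolding \<mu>_def using I w qh[OF that(1)] that(2) by (intro integral_two_sided) auto
  have mom: "(\<integral>x. x ^ k \<partial>\<mu> q n) = c q k" if q: "cmod q \<le> 1" and k: "k \<le> Suc (Suc n)" for q n k
  proof (cases "even k")
    case True
    then show ?thesis
      by (simp add: integral[OF q] c_def m[OF k] del: of_real_mult)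
  next
    case False
    have "q * m k = (\<Sum>i\<in>I n. of_real (w n i * d n i ^ k) * (q * h n i))"
      using False by (simp add: m[OF k] sum_distrib_left mult_ac)
    moreover have "Re (of_real a * z) = a * Re z" for a z by simp
    ultimately have "Re (q * m k) = (\<Sum>i\<in>I n. w n i * d n i ^ k * Re (q * h n i))"
      by (simp only: Re_sum)
    then show ?thesis using False by (simp add: integral[OF q] c_def mult_ac)
  qed
  have tight: "tight (\<mu> q)" if q: "cmod q \<le> 1" for q
  proof (rule tight_if_second_moment)
    show "integrable (\<mu> q n) (\<lambda>x. x\<^sup>2)" for n by (intro int[OF q]) simp
    show "(\<integral>x. x\<^sup>2 \<partial>\<mu> q n) \<le> c q 2" for n by (simp add: mom[OF q])
  qed (rule dist[OF q])
  \<comment> \<open>Helly's theorem is used three times, each time along the previous subsequence,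
    so that the three limits share one.\<close>
  obtain r1 S where r1: "strict_mono r1" "real_distribution S" "weak_conv_m (\<mu> 0 \<circ> id \<circ> r1) S"
    using tight_imp_convergent_subsubsequence[OF tight[of 0] strict_mono_id] by auto
  obtain r2 P where r2: "strict_mono r2" "real_distribution P" "weak_conv_m (\<mu> 1 \<circ> r1 \<circ> r2) P"
    using tight_imp_convergent_subsubsequence[OF tight[of 1] r1(1)] by auto
  have r12: "strict_mono (r1 \<circ> r2)" using r1 r2 by (simp add: strict_mono_o)
  obtain r3 Q where r3: "strict_mono r3" "real_distribution Q" "weak_conv_m (\<mu> (- \<i>) \<circ> (r1 \<circ> r2) \<circ> r3) Q"
    using tight_imp_convergent_subsubsequence[OF tight[of "- \<i>"] r12] by auto
  define r where "r = r1 \<circ> r2 \<circ> r3"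
  have r: "strict_mono r" using r12 r3 by (simp add: strict_mono_o r_def)
  have weak_S: "weak_conv_m (\<lambda>n. \<mu> 0 (r n)) S"
    using weak_conv_m_subseq[OF weak_conv_m_subseq[OF r1(3) r2(1)] r3(1)] by (simp add: r_def o_def)
  have weak_P: "weak_conv_m (\<lambda>n. \<mu> 1 (r n)) P"
    using weak_conv_m_subseq[OF r2(3) r3(1)] by (simp add: r_def o_def)
  have weak_Q: "weak_conv_m (\<lambda>n. \<mu> (- \<i>) (r n)) Q"
    using r3(3) by (simp add: r_def o_def)
  interpret S: real_distribution S by fact
  interpret P: real_distribution P by fact
  interpret Q: real_distribution Q by fact
  have limit_mom: "integrable M (\<lambda>x. x ^ k) \<and> (\<integral>x. x ^ k \<partial>M) = c q k"
    if M: "real_distribution M" "weak_conv_m (\<lambda>n. \<mu> q (r n)) M" and q: "cmod q \<le> 1" for M q k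
  proof -
    have "\<forall>\<^sub>F n in sequentially. (\<integral>x. x ^ k \<partial>\<mu> q (r n)) = c q k" for k
      using eventually_ge_at_top[of k]
    proof eventually_elim
      case (elim n)
      then show ?case using seq_suble[OF r, of n] by (intro mom[OF q]) linarith
    qed
    then show ?thesis
      using weak_limit_moments[OF dist[OF q] M int[OF q], where c = "c q"] by auto
  qed
  note S_mom = limit_mom[OF S.real_distribution_axioms weak_S, simplified]
    and P_mom = limit_mom[OF P.real_distribution_axioms weak_P, simplified]
    and Q_mom = limit_mom[OF Q.real_distribution_axioms weak_Q, simplified]
  have lim: "(\<lambda>n. integral\<^sup>L (\<mu> q (r n)) f) \<longlonglongrightarrow> integral\<^sup>L M f"
    if "real_distribution M" "weak_conv_m (\<lambda>n. \<mu> q (r n)) M" "cmod q \<le> 1"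
      and f: "continuous_on UNIV f" "\<And>x. 0 \<le> f x" "\<And>x. f x \<le> 1" for M q and f :: "real \<Rightarrow> real"
    using f by (intro weak_conv_imp_integral_bdd_continuous_conv[OF dist that(1,2), where B = 1])
      (auto simp: continuous_on_eq_continuous_at that(3))
  \<comment> \<open>Split \<open>f\<close> at \<open>d n i\<close> into an even part
    \<open>e\<close> and an odd part \<open>u\<close>. The coefficient of \<open>S\<close> is chosen
    so that the combination becomes a sum of \<open>w * (cmod q * e + Re (q * h) * u)\<close>,
    nonnegative since \<bar>u\<bar> \<le> e and \<open>h\<close> lies in the disc; this survives the
    limit.\<close>
  have pos: "0 \<le> (cmod q - Re q + Im q) * integral\<^sup>L S f + Re q * integral\<^sup>L P f - Im q * integral\<^sup>L Q f"
    if f: "continuous_on UNIV f" "\<And>x. 0 \<le> f x" "\<And>x. f x \<le> 1" for q and f :: "real \<Rightarrow> real"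
  proof (rule tendsto_lowerbound)
    show "(\<lambda>n. (cmod q - Re q + Im q) * integral\<^sup>L (\<mu> 0 (r n)) f + Re q * integral\<^sup>L (\<mu> 1 (r n)) f
        - Im q * integral\<^sup>L (\<mu> (- \<i>) (r n)) f) \<longlonglongrightarrow>
      (cmod q - Re q + Im q) * integral\<^sup>L S f + Re q * integral\<^sup>L P f - Im q * integral\<^sup>L Q f"
      using f S.real_distribution_axioms P.real_distribution_axioms Q.real_distribution_axioms
        weak_S weak_P weak_Q
      by (intro tendsto_intros lim) auto
    have [measurable]: "f \<in> borel_measurable borel" using f(1) by (rule borel_measurable_continuous_onI)
    have "0 \<le> (cmod q - Re q + Im q) * integral\<^sup>L (\<mu> 0 n) f + Re q * integral\<^sup>L (\<mu> 1 n) f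
        - Im q * integral\<^sup>L (\<mu> (- \<i>) n) f" for n
    proof -
      define e where "e i = (f (d n i) + f (- d n i)) / 2" for i
      define u where "u i = (f (d n i) - f (- d n i)) / 2" for i
      have eu: "integral\<^sup>L (\<mu> s n) f = (\<Sum>i\<in>I n. w n i * (e i + Re (s * h n i) * u i))"
        if "cmod s \<le> 1" for s
        by (simp only: integral[OF that] \<open>f \<in> borel_measurable borel\<close> e_def u_def)
      have eus: "integral\<^sup>L (\<mu> 0 n) f = (\<Sum>i\<in>I n. w n i * e i)"
        "integral\<^sup>L (\<mu> 1 n) f = (\<Sum>i\<in>I n. w n i * (e i + Re (h n i) * u i))"
        "integral\<^sup>L (\<mu> (- \<i>) n) f = (\<Sum>i\<in>I n. w n i * (e i + Im (h n i) * u i))"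
        using eu[of 0] eu[of 1] eu[of "- \<i>"] by simp_all
      have eq: "(cmod q - Re q + Im q) * integral\<^sup>L (\<mu> 0 n) f + Re q * integral\<^sup>L (\<mu> 1 n) f
        - Im q * integral\<^sup>L (\<mu> (- \<i>) n) f = (\<Sum>i\<in>I n. w n i * (cmod q * e i + Re (q * h n i) * u i))"
        unfolding eus sum_distrib_left sum.distrib[symmetric] sum_subtractf[symmetric]
        by (intro sum.cong refl) (simp add: algebra_simps)
      show ?thesis
        unfolding eq
      proof (intro sum_nonneg mult_nonneg_nonneg w)
        fix i
        have "\<bar>Re (q * h n i)\<bar> \<le> cmod q"
          using abs_Re_le_cmod[of "q * h n i"] mult_left_mono[OF h[of n i], of "cmod q"]
          by (simp add: norm_mult)
        moreover have "\<bar>u i\<bar> \<le> e i"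
          using f(2)[of "d n i"] f(2)[of "- d n i"] by (simp add: u_def e_def)
        ultimately have "\<bar>Re (q * h n i) * u i\<bar> \<le> cmod q * e i"
          unfolding abs_mult by (intro mult_mono) auto
        then show "0 \<le> cmod q * e i + Re (q * h n i) * u i" by linarith
      qed
    qed
    then show "\<forall>\<^sub>F n in sequentially. 0 \<le> (cmod q - Re q + Im q) * integral\<^sup>L (\<mu> 0 (r n)) f
        + Re q * integral\<^sup>L (\<mu> 1 (r n)) f - Im q * integral\<^sup>L (\<mu> (- \<i>) (r n)) f" by simp
  qed simp
  \<comment> \<open>At \<open>q = - 1\<close> the inequality \<open>pos\<close> bounds the integral
    for \<open>P\<close> by twice that for \<open>S\<close>; \<open>q = \<i>\<close> does the same
    for \<open>Q\<close> below.\<close>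
  obtain g1 :: "real \<Rightarrow> real" where g1 [measurable]: "g1 \<in> borel_measurable borel" and g1_nonneg: "\<And>x. 0 \<le> g1 x"
    and P: "P = density S (\<lambda>x. ennreal (g1 x))"
    by (rule density_if_integral_le[OF S.finite_measure_axioms P.finite_measure_axioms, of 2])
      (use pos[of _ "- 1"] in auto)
  obtain g2 :: "real \<Rightarrow> real" where g2 [measurable]: "g2 \<in> borel_measurable borel" and g2_nonneg: "\<And>x. 0 \<le> g2 x"
    and Q: "Q = density S (\<lambda>x. ennreal (g2 x))"
    by (rule density_if_integral_le[OF S.finite_measure_axioms Q.finite_measure_axioms, of 2])
      (use pos[of _ "\<i>"] in auto)
  have P_eq: "integrable P f \<longleftrightarrow> integrable S (\<lambda>x. g1 x * f x)" "integral\<^sup>L P f = (\<integral>x. g1 x * f x \<partial>S)"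
    and Q_eq: "integrable Q f \<longleftrightarrow> integrable S (\<lambda>x. g2 x * f x)" "integral\<^sup>L Q f = (\<integral>x. g2 x * f x \<partial>S)"
    if [measurable]: "f \<in> borel_measurable borel" for f :: "real \<Rightarrow> real"
    using g1_nonneg g2_nonneg by (simp_all add: P Q integrable_density integral_density)
  have g_int: "integrable S g1" "integrable S g2"
    using P_eq(1)[of "\<lambda>_. 1"] Q_eq(1)[of "\<lambda>_. 1"] by auto
  \<comment> \<open>As \<open>q\<close> varies, the inequality \<open>pos\<close> says that the density \<open>z\<close> takes values in the unit disc.\<close>
  define z where "z x = Complex (g1 x - 1) (g2 x - 1)" for x
  have z_meas [measurable]: "z \<in> borel_measurable borel"
    unfolding z_def Complex_eq by measurable
  \<comment> \<open>The densities of \<open>P\<close> and \<open>Q\<close> are 1 plus the real and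
    imaginary part of \<open>z\<close>, so testing the claim against \<open>f\<close> gives exactly
    the expression in \<open>pos\<close>.\<close>
  have z_AE: "AE x in S. 0 \<le> cmod q + Re (q * z x)" for q
  proof (rule AE_nonneg_if_integral_continuous_nonneg)
    show "integrable S (\<lambda>x. cmod q + Re (q * z x))"
      using g_int by (simp add: z_def)
    fix f :: "real \<Rightarrow> real"
    assume f: "continuous_on UNIV f" "\<And>x. 0 \<le> f x" "\<And>x. f x \<le> 1"
    have [measurable]: "f \<in> borel_measurable borel" using f(1) by (rule borel_measurable_continuous_onI)
    have bdd: "integrable M f" if "real_distribution M" for M
    proof -
      interpret M: real_distribution M by fact
      show ?thesis using f by (intro M.integrable_const_bound[where B = 1]) auto
    qed
    have i: "integrable S f" "integrable S (\<lambda>x. g1 x * f x)" "integrable S (\<lambda>x. g2 x * f x)"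
      using bdd[OF S.real_distribution_axioms] bdd[OF P.real_distribution_axioms]
        bdd[OF Q.real_distribution_axioms] by (simp_all add: P_eq Q_eq)
    have "(\<integral>x. f x * (cmod q + Re (q * z x)) \<partial>S) =
      (\<integral>x. (cmod q - Re q + Im q) * f x + Re q * (g1 x * f x) - Im q * (g2 x * f x) \<partial>S)"
      by (intro Bochner_Integration.integral_cong) (auto simp: z_def algebra_simps)
    also have "\<dots> = (cmod q - Re q + Im q) * integral\<^sup>L S f + Re q * integral\<^sup>L P f - Im q * integral\<^sup>L Q f"
      using i by (simp add: P_eq Q_eq)
    finally show "0 \<le> (\<integral>x. f x * (cmod q + Re (q * z x)) \<partial>S)" using pos[OF f] by simp
  qed simp
  \<comment> \<open>The exceptional null set depends on \<open>q\<close>; a countable dense set of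
    \<open>q\<close> gives a common one, and continuity in \<open>q\<close> does the rest.\<close>
  obtain D :: "complex set" where D: "countable D" "\<And>X. open X \<Longrightarrow> X \<noteq> {} \<Longrightarrow> \<exists>q\<in>D. q \<in> X"
    using countable_dense_setE by metis
  have "AE x in S. \<forall>q\<in>D. 0 \<le> cmod q + Re (q * z x)"
    using z_AE D(1) by (simp add: AE_ball_countable)
  then have z_le: "AE x in S. cmod (z x) \<le> 1"
  proof eventually_elim
    case (elim x)
    have "open {q. cmod q + Re (q * z x) < 0}"
      by (intro open_Collect_less continuous_intros)
    then have "{q. cmod q + Re (q * z x) < 0} = {}"
      using D(2)[of "{q. cmod q + Re (q * z x) < 0}"] elim by fastforce
    \<comment> \<open>The extremal \<open>q\<close> for the point \<open>z x\<close>: the inequality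
      becomes \<bar>z\<bar> - \<open>\<bar>z\<bar>\<^sup>2\<close> \<ge> 0.\<close>
    then have "0 \<le> cmod (- cnj (z x)) + Re (- cnj (z x) * z x)"
      by (metis (mono_tags, lifting) empty_iff mem_Collect_eq not_le)
    moreover have "Re (cnj (z x) * z x) = (cmod (z x))\<^sup>2"
      unfolding cmod_power2 by (simp add: power2_eq_square)
    ultimately have "cmod (z x) * cmod (z x) \<le> cmod (z x)" by (simp add: power2_eq_square)
    then show ?case by (cases "z x = 0") (auto simp: mult_le_cancel_right2)
  qed
  define z' where "z' x = (if cmod (z x) \<le> 1 then z x else 0)" for x
  have [measurable]: "z' \<in> borel_measurable borel" unfolding z'_def by measurable
  have z'_le: "cmod (z' x) \<le> 1" for x by (simp add: z'_def)
  \<comment> \<open>Taking the odd part of \<open>z'\<close> preserves its odd moments, because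
    \<open>S\<close> is symmetric.\<close>
  define H where "H x = (z' x - z' (- x)) / 2" for x
  have sym_integral: "(\<integral>x. f (- x) \<partial>S) = integral\<^sup>L S f"
    if f: "continuous_on UNIV f" "\<And>x. 0 \<le> f x" "\<And>x. f x \<le> 1" for f :: "real \<Rightarrow> real"
  proof -
    have [measurable]: "f \<in> borel_measurable borel" using f(1) by (rule borel_measurable_continuous_onI)
    have "(\<lambda>n. \<integral>x. f (- x) \<partial>\<mu> 0 (r n)) \<longlonglongrightarrow> (\<integral>x. f (- x) \<partial>S)"
      using f by (intro lim[OF S.real_distribution_axioms weak_S])
        (auto intro!: continuous_on_compose2[OF f(1)] continuous_intros)
    moreover have "(\<integral>x. f (- x) \<partial>\<mu> 0 n) = integral\<^sup>L (\<mu> 0 n) f" for n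
      by (simp add: integral add.commute)
    ultimately show ?thesis
      using LIMSEQ_unique lim[OF S.real_distribution_axioms weak_S _ f] by auto
  qed
  have sym: "distr S borel uminus = S"
  proof (rule measure_eqI)
    fix E assume "E \<in> sets (distr S borel uminus)"
    then have E: "E \<in> sets borel" by simp
    have fin: "finite_measure (distr S borel uminus)"
      by (rule S.finite_measure_distr) simp
    have "emeasure (distr S borel uminus) E \<le> emeasure S E"
      by (rule measure_le_if_integral_le[OF fin S.finite_measure_axioms _ _ _ E])
        (simp_all add: integral_distr borel_measurable_continuous_onI sym_integral)
    moreover have "emeasure S E \<le> emeasure (distr S borel uminus) E"
      by (rule measure_le_if_integral_le[OF S.finite_measure_axioms fin _ _ _ E])
        (simp_all add: integral_distr borel_measurable_continuous_onI sym_integral)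
    ultimately show "emeasure (distr S borel uminus) E = emeasure S E" by simp
  qed simp
  \<comment> \<open>For odd \<open>k\<close> the moment of \<open>S\<close> vanishes, so subtracting
    it from those of \<open>P\<close> and \<open>Q\<close> leaves the real and imaginary part of
    \<open>m k\<close>.\<close>
  have z_mom: "(\<integral>x. of_real (x ^ k) * z' x \<partial>S) = m k" "integrable S (\<lambda>x. of_real (x ^ k) * z' x)"
    if "odd k" for k
  proof -
    have i: "integrable S (\<lambda>x. (g1 x - 1) * x ^ k)" "integrable S (\<lambda>x. (g2 x - 1) * x ^ k)"
      using S_mom[of k] P_mom[of k] Q_mom[of k] by (auto simp: P_eq Q_eq left_diff_distrib)
    have "(\<integral>x. (g1 x - 1) * x ^ k \<partial>S) = Re (m k)" "(\<integral>x. (g2 x - 1) * x ^ k \<partial>S) = Im (m k)"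
      using S_mom[of k] P_mom[of k] Q_mom[of k] that by (simp_all add: P_eq Q_eq left_diff_distrib c_def)
    moreover have eq: "of_real (x ^ k) * z x = of_real ((g1 x - 1) * x ^ k) + \<i> * of_real ((g2 x - 1) * x ^ k)" for x
      by (simp add: z_def Complex_eq algebra_simps)
    ultimately have "(\<integral>x. of_real (x ^ k) * z x \<partial>S) = m k"
      unfolding eq using i by (subst Bochner_Integration.integral_add) (auto simp: complex_eq[symmetric] simp del: of_real_mult of_real_diff of_real_power)
    moreover have "integrable S (\<lambda>x. of_real (x ^ k) * z x)"
      unfolding eq using i by (intro Bochner_Integration.integrable_add integrable_mult_right integrable_of_real)
    moreover have "AE x in S. of_real (x ^ k) * z' x = of_real (x ^ k) * z x"
      using z_le by eventually_elim (simp add: z'_def)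
    ultimately show "(\<integral>x. of_real (x ^ k) * z' x \<partial>S) = m k" "integrable S (\<lambda>x. of_real (x ^ k) * z' x)"
      using integral_cong_AE[of "\<lambda>x. of_real (x ^ k) * z' x" S "\<lambda>x. of_real (x ^ k) * z x"]
        integrable_cong_AE[of "\<lambda>x. of_real (x ^ k) * z' x" S "\<lambda>x. of_real (x ^ k) * z x"]
      by auto
  qed
  show thesis
  proof (rule that[of S H])
    show "cmod (H x) \<le> 1" for x
      using norm_triangle_ineq4[of "z' x" "z' (- x)"] z'_le[of x] z'_le[of "- x"]
      by (simp add: H_def norm_divide)
    show "H (- x) = - H x" for x by (simp add: H_def field_simps)
    show "H \<in> borel_measurable borel" unfolding H_def by measurable
    show "integrable S (\<lambda>x. x ^ k)" for k using S_mom by simp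
    show "m k = (\<integral>x. of_real (x ^ k) * (if even k then 1 else H x) \<partial>S)" for k
    proof (cases "even k")
      case True
      have "m k = of_real (\<Sum>i\<in>I k. w k i * d k i ^ k)" using m[of k k] True by simp
      then have "m k = of_real (c 0 k)" using True by (simp add: c_def)
      then show ?thesis using True S_mom[of k] by (simp flip: of_real_power)
    next
      case False
      let ?f = "\<lambda>x. of_real (x ^ k) * z' x"
      have "integral\<^sup>L (distr S borel uminus) ?f = (\<integral>x. ?f (- x) \<partial>S)"
        by (rule integral_distr) measurable
      moreover have "integrable (distr S borel uminus) ?f \<longleftrightarrow> integrable S (\<lambda>x. ?f (- x))"
        by (rule integrable_distr_eq) measurable
      ultimately have "(\<integral>x. ?f (- x) \<partial>S) = m k" "integrable S (\<lambda>x. ?f (- x))"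
        using z_mom[OF False] unfolding sym by auto
      then have "(\<integral>x. (?f x + ?f (- x)) / 2 \<partial>S) = m k"
        using z_mom[OF False] by (simp del: of_real_minus of_real_power)
      also have "(\<lambda>x. (?f x + ?f (- x)) / 2) = (\<lambda>x. of_real (x ^ k) * H x)"
        using False by (auto simp: H_def field_simps)
      finally show ?thesis using False by simp
    qed
  qed (use sym S.real_distribution_axioms in auto)
qed

section \<open>Biradial measures\<close>

text \<open>\<open>Arg\<close> is continuous off the closed negative axis and constantly
  \<open>pi\<close> on it, except for the value 0 at the origin.\<close>

lemma borel_measurable_Arg [measurable]: "Arg \<in> borel_measurable borel"
proof -
  have "(\<lambda>z. indicator (- \<real>\<^sub>\<le>\<^sub>0) z *\<^sub>R Arg z) \<in> borel_measurable borel"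
    by (intro borel_measurable_continuous_on_indicator continuous_at_imp_continuous_on ballI continuous_at_Arg)
      (auto simp: borel_closed)
  moreover have "\<real>\<^sub>\<le>\<^sub>0 \<in> sets (borel :: complex measure)" by (simp add: borel_closed)
  then have "(\<lambda>z. indicator (\<real>\<^sub>\<le>\<^sub>0 - {0}) z *\<^sub>R pi) \<in> borel_measurable (borel :: complex measure)"
    by (intro borel_measurable_scaleR borel_measurable_indicator) auto
  ultimately have "(\<lambda>z. indicator (- \<real>\<^sub>\<le>\<^sub>0) z *\<^sub>R Arg z + indicator (\<real>\<^sub>\<le>\<^sub>0 - {0}) z *\<^sub>R pi)
      \<in> borel_measurable borel" by (rule borel_measurable_add)
  also have "(\<lambda>z. indicator (- \<real>\<^sub>\<le>\<^sub>0) z *\<^sub>R Arg z + indicator (\<real>\<^sub>\<le>\<^sub>0 - {0}) z *\<^sub>R pi) = Arg"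
  proof
    fix z
    have "Arg z = pi" if "z \<in> \<real>\<^sub>\<le>\<^sub>0" "z \<noteq> 0"
      using that by (auto simp: Arg_eq_pi complex_nonpos_Reals_iff complex_eq_iff)
    then show "indicator (- \<real>\<^sub>\<le>\<^sub>0) z *\<^sub>R Arg z + indicator (\<real>\<^sub>\<le>\<^sub>0 - {0}) z *\<^sub>R pi = Arg z"
      by (auto simp: indicator_def Arg_zero)
  qed
  finally show ?thesis .
qed

text \<open>With \<alpha> = \<open>Arg z\<close> and \<beta> = \<open>arccos (cmod z)\<close>, the
  two phases \<alpha> + \<beta> and \<alpha> - \<beta> add up to 2 cos \<beta> times the phase
  \<alpha>.\<close>

lemma unit_disc_average:
  assumes "cmod z \<le> 1"
  shows "exp (\<i> * of_real (Arg z + arccos (cmod z))) + exp (\<i> * of_real (Arg z - arccos (cmod z))) = 2 * z"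
proof -
  have "exp (\<i> * of_real (Arg z + arccos (cmod z))) + exp (\<i> * of_real (Arg z - arccos (cmod z)))
      = 2 * cos (arccos (cmod z)) * cis (Arg z)"
    unfolding cis_conv_exp[symmetric] by (simp add: complex_eq_iff cos_add cos_diff sin_add sin_diff)
  also have "cos (arccos (cmod z)) = cmod z"
    using assms by (intro cos_arccos) (auto intro: order_trans[OF _ norm_ge_zero])
  finally show ?thesis using rcis_cmod_Arg[of z] by (simp add: rcis_def)
qed

lemma emeasure_folded_density:
  fixes S :: "real measure"
  assumes [measurable_cong]: "sets S = sets borel" and [measurable]: "A \<in> sets borel"
    and B: "B \<in> sets (restrict_space borel {0..})"
  shows "emeasure (distr (density S (indicator A)) (restrict_space borel {0..}) abs) B =
    emeasure S {x \<in> A. \<bar>x\<bar> \<in> B}"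
proof -
  have [simp]: "space S = UNIV" using assms(1) by (auto dest: sets_eq_imp_space_eq)
  have [measurable]: "B \<in> sets borel" using B by (auto simp: sets_restrict_space_iff)
  have "abs \<in> measurable (density S (indicator A)) (restrict_space borel {0..})"
    by (rule measurable_restrict_space2) auto
  then have "emeasure (distr (density S (indicator A)) (restrict_space borel {0..}) abs) B
      = emeasure (density S (indicator A)) (abs -` B)"
    using B by (simp add: emeasure_distr)
  also have "abs -` B \<inter> space S \<in> sets S" by (rule measurable_sets[where A = borel]) auto
  then have "emeasure (density S (indicator A)) (abs -` B) = emeasure S (A \<inter> abs -` B)"
    by (subst emeasure_restricted) auto
  also have "A \<inter> abs -` B = {x \<in> A. \<bar>x\<bar> \<in> B}" by auto
  finally show ?thesis .
qed

text \<open>Even moments depend only on the radius. For odd ones the symmetry of \<open>S\<close>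
  averages the two phases at each radius, and this average is \<open>H\<close>.\<close>

lemma biradial_representation:
  fixes S :: "real measure" and H :: "real \<Rightarrow> complex"
  assumes S: "prob_space S" "sets S = sets borel" and sym: "distr S borel uminus = S"
    and int: "\<And>k. integrable S (\<lambda>x. x ^ k)"
    and H [measurable]: "H \<in> borel_measurable borel" and H_le: "\<And>x. cmod (H x) \<le> 1"
    and H_odd: "\<And>x. H (- x) = - H x"
  obtains \<rho> where "biradial \<rho>" "finite_moments \<rho>"
    "\<And>k. (\<integral>z. angle_power z k \<partial>\<rho>) = (\<integral>x. of_real (x ^ k) * (if even k then 1 else H x) \<partial>S)"
proof -
  interpret prob_space S by fact
  note [measurable_cong] = S(2)
  have [simp]: "space S = UNIV" using S(2) by (auto dest: sets_eq_imp_space_eq)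
  \<comment> \<open>By \<open>H_le\<close> the \<open>min\<close> keeps the value; it confines the
    argument of \<open>arccos\<close> to its interval of continuity, from which measurability
    follows.\<close>
  define \<phi>1 where "\<phi>1 x = Arg (H x) + arccos (min 1 (cmod (H x)))" for x
  define \<phi>2 where "\<phi>2 x = Arg (H x) - arccos (min 1 (cmod (H x)))" for x
  have min: "min 1 (cmod (H x)) = cmod (H x)" for x using H_le[of x] by simp
  have "continuous_on UNIV (\<lambda>r. arccos (max (- 1) (min 1 r)))"
    by (intro continuous_intros) auto
  then have "(\<lambda>r. arccos (max (- 1) (min 1 r))) \<in> borel_measurable borel"
    by (rule borel_measurable_continuous_onI)
  then have "(\<lambda>x. arccos (max (- 1) (min 1 (cmod (H x))))) \<in> borel_measurable borel"
    by (rule measurable_compose[rotated]) measurable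
  moreover have "max (- 1) (min 1 (cmod z)) = min 1 (cmod z)" for z
    by (simp add: max_absorb2 order_trans[OF _ norm_ge_zero])
  ultimately have [measurable]: "(\<lambda>x. arccos (min 1 (cmod (H x)))) \<in> borel_measurable borel" by simp
  have \<phi> [measurable]: "\<phi>1 \<in> borel_measurable borel" "\<phi>2 \<in> borel_measurable borel"
    unfolding \<phi>1_def \<phi>2_def by measurable
  have \<phi>_sum: "exp (\<i> * of_real (\<phi>1 x)) + exp (\<i> * of_real (\<phi>2 x)) = 2 * H x" for x
    using unit_disc_average[OF H_le[of x]] by (simp only: \<phi>1_def \<phi>2_def min)
  \<comment> \<open>The two halves of the line carry the two phases; by symmetry both halves have the same radial law.\<close>
  define \<psi> where "\<psi> x = (if 0 \<le> x then of_real x * exp (\<i> * of_real (\<phi>1 x))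
      else of_real \<bar>x\<bar> * exp (\<i> * of_real (\<phi>2 \<bar>x\<bar>)))" for x
  have \<psi> [measurable]: "\<psi> \<in> borel_measurable borel" unfolding \<psi>_def by measurable
  have norm_\<psi>: "cmod (\<psi> x) = \<bar>x\<bar>" for x by (simp add: \<psi>_def norm_mult)
  define \<rho> where "\<rho> = distr S borel \<psi>"
  have abs_int: "integrable S (\<lambda>x. \<bar>x\<bar> ^ k)" for k
    using integrable_abs[OF int[of k]] by (simp add: power_abs)
  define \<rho>1 where "\<rho>1 = distr (density S (indicator {0..})) (restrict_space borel {0..}) abs"
  define \<rho>2 where "\<rho>2 = distr (density S (indicator {..<0})) (restrict_space borel {0..}) abs"
  have \<rho>12: "emeasure \<rho>1 B = emeasure S {x \<in> {0..}. \<bar>x\<bar> \<in> B}" "emeasure \<rho>2 B = emeasure S {x \<in> {..<0}. \<bar>x\<bar> \<in> B}"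
    if "B \<in> sets (restrict_space borel {0..})" for B
    unfolding \<rho>1_def \<rho>2_def using that S(2) by (simp_all add: emeasure_folded_density)
  show thesis
  proof (rule that)
    show "finite_moments \<rho>"
      unfolding finite_moments_def
    proof
      fix n
      have "(\<integral>\<^sup>+ z. ennreal (cmod z ^ n) \<partial>\<rho>) = (\<integral>\<^sup>+ x. ennreal (\<bar>x\<bar> ^ n) \<partial>S)"
        unfolding \<rho>_def by (subst nn_integral_distr) (auto simp: norm_\<psi>)
      also have "\<dots> < \<infinity>" using abs_int[of n] by (simp add: nn_integral_eq_integral)
      finally show "(\<integral>\<^sup>+ z. ennreal (cmod z ^ n) \<partial>\<rho>) < \<infinity>" .
    qed
    have E: "emeasure \<rho> E = emeasure \<rho>1 {r. 0 \<le> r \<and> of_real r * exp (\<i> * of_real (\<phi>1 r)) \<in> E} +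
           emeasure \<rho>2 {r. 0 \<le> r \<and> of_real r * exp (\<i> * of_real (\<phi>2 r)) \<in> E}"
      if [measurable]: "E \<in> sets borel" for E
    proof -
      have sets: "{r. 0 \<le> r \<and> of_real r * exp (\<i> * of_real (\<phi> r)) \<in> E} \<in> sets (restrict_space borel {0..})"
        if [measurable]: "\<phi> \<in> borel_measurable borel" for \<phi> :: "real \<Rightarrow> real"
      proof -
        have "{r. 0 \<le> r \<and> of_real r * exp (\<i> * of_real (\<phi> r)) \<in> E} \<in> sets borel" by measurable
        then show ?thesis by (subst sets_restrict_space_iff) auto
      qed
      have "{x \<in> {0..}. \<psi> x \<in> E} \<in> sets S" "{x \<in> {..<0}. \<psi> x \<in> E} \<in> sets S" by measurable
      then have "emeasure S ({x \<in> {0..}. \<psi> x \<in> E} \<union> {x \<in> {..<0}. \<psi> x \<in> E}) =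
          emeasure S {x \<in> {0..}. \<psi> x \<in> E} + emeasure S {x \<in> {..<0}. \<psi> x \<in> E}"
        by (intro plus_emeasure[symmetric]) auto
      moreover have "emeasure \<rho> E = emeasure S ({x \<in> {0..}. \<psi> x \<in> E} \<union> {x \<in> {..<0}. \<psi> x \<in> E})"
        unfolding \<rho>_def by (subst emeasure_distr) (auto intro!: arg_cong[where f = "emeasure S"])
      moreover have "{x \<in> {0..}. \<psi> x \<in> E} = {x \<in> {0..}. \<bar>x\<bar> \<in> {r. 0 \<le> r \<and> of_real r * exp (\<i> * of_real (\<phi>1 r)) \<in> E}}"
        "{x \<in> {..<0}. \<psi> x \<in> E} = {x \<in> {..<0}. \<bar>x\<bar> \<in> {r. 0 \<le> r \<and> of_real r * exp (\<i> * of_real (\<phi>2 r)) \<in> E}}"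
        by (auto simp: \<psi>_def)
      ultimately show ?thesis using \<rho>12 sets \<phi> by simp
    qed
    show "biradial \<rho>"
      unfolding biradial_def
    proof (rule conjI, simp add: \<rho>_def, rule exI[of _ \<rho>1], rule exI[of _ \<rho>2], rule exI[of _ \<phi>1],
        rule exI[of _ \<phi>2], intro conjI ballI)
      show "emeasure \<rho>1 {0..} + emeasure \<rho>2 {0..} = 1"
      proof -
        interpret \<rho>: prob_space \<rho> unfolding \<rho>_def by (rule prob_space_distr) simp
        have "emeasure \<rho> UNIV = 1" using \<rho>.emeasure_space_1 by (simp add: \<rho>_def)
        then show ?thesis using E[of UNIV] by (simp add: atLeast_def)
      qed
      show "\<phi>1 \<in> borel_measurable (restrict_space borel {0..})" "\<phi>2 \<in> borel_measurable (restrict_space borel {0..})"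
        using \<phi> by (auto intro: measurable_restrict_space1)
    qed (use E in \<open>auto simp: \<rho>1_def \<rho>2_def\<close>)
    fix k
    have [measurable]: "(\<lambda>z. angle_power z k) \<in> borel_measurable borel"
      unfolding angle_power_def by measurable
    have \<rho>_int: "(\<integral>z. angle_power z k \<partial>\<rho>) = (\<integral>x. angle_power (\<psi> x) k \<partial>S)"
      unfolding \<rho>_def by (rule integral_distr) auto
    show "(\<integral>z. angle_power z k \<partial>\<rho>) = (\<integral>x. of_real (x ^ k) * (if even k then 1 else H x) \<partial>S)"
    proof (cases "even k")
      case True
      then show ?thesis unfolding \<rho>_int by (simp add: angle_power_def norm_\<psi> power_even_abs flip: of_real_power)
    next
      case False
      let ?f = "\<lambda>x. angle_power (\<psi> x) k"
      have f: "?f x = \<psi> x * of_real (\<bar>x\<bar> ^ (k - 1))" for x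
        using False by (simp add: angle_power_def norm_\<psi>)
      have k: "k = Suc (k - 1)" "even (k - 1)" using False by (auto simp: odd_pos)
      \<comment> \<open>Strict positivity matters: at 0 the points \<open>x\<close> and
        \<open>- x\<close> coincide and only \<open>\<phi>1\<close> occurs. There the radius makes
        both sides of \<open>avg\<close> zero.\<close>
      have avg_pos: "?f x + ?f (- x) = 2 * (of_real (x ^ k) * H x)" if "0 < x" for x
      proof -
        have "?f x + ?f (- x) = of_real (x * x ^ (k - 1)) *
            (exp (\<i> * of_real (\<phi>1 x)) + exp (\<i> * of_real (\<phi>2 x)))"
          using that unfolding f by (simp add: \<psi>_def algebra_simps)
        also have "x * x ^ (k - 1) = x ^ k" using k(1) by (metis power_Suc)
        finally show ?thesis by (simp add: \<phi>_sum)
      qed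
      have avg: "?f x + ?f (- x) = 2 * (of_real (x ^ k) * H x)" for x
      proof (cases x "0 :: real" rule: linorder_cases)
        case less
        then show ?thesis using avg_pos[of "- x"] False by (simp add: H_odd add.commute)
      next
        case equal
        then show ?thesis using False by (cases k) (auto simp: angle_power_def \<psi>_def)
      qed (rule avg_pos)
      have f_int: "integrable S ?f"
      proof (rule Bochner_Integration.integrable_bound[OF abs_int[of k]])
        have "norm (?f x) = \<bar>x\<bar> ^ k" for x 
          using False by (cases k) (simp_all add: angle_power_def norm_\<psi> norm_mult norm_power)
        then show "AE x in S. norm (?f x) \<le> norm (\<bar>x\<bar> ^ k)" by simp
      qed simp
      have "integral\<^sup>L (distr S borel uminus) ?f = (\<integral>x. ?f (- x) \<partial>S)"
        by (rule integral_distr) measurable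
      moreover have "integrable (distr S borel uminus) ?f \<longleftrightarrow> integrable S (\<lambda>x. ?f (- x))"
        by (rule integrable_distr_eq) measurable
      ultimately have "integral\<^sup>L S ?f = (\<integral>x. ?f (- x) \<partial>S)" "integrable S (\<lambda>x. ?f (- x))"
        using f_int unfolding sym by auto
      then have "2 * integral\<^sup>L S ?f = (\<integral>x. ?f x + ?f (- x) \<partial>S)" using f_int by simp
      also have "\<dots> = 2 * (\<integral>x. of_real (x ^ k) * H x \<partial>S)" unfolding avg by simp
      finally show ?thesis using False by (simp add: \<rho>_int)
    qed
  qed
qed

section \<open>Positive semidefiniteness of the moment matrix\<close>

lemma leading_submatrix_index:
  "i < k \<Longrightarrow> j < k \<Longrightarrow> leading_submatrix (moment_matrix m) k $$ (i, j) =
    (if even j then m (i + j) else cnj (m (i + j)))"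
  by (simp add: leading_submatrix_def moment_matrix_def)

text \<open>The double conjugate gives the shape \<open>x i * cnj (x j)\<close> with
  \<open>x i = cnj (v $ i)\<close>, matching the form on polynomial coefficients.\<close>

lemma leading_submatrix_quadratic_form:
  assumes "v \<in> carrier_vec k"
  shows "(leading_submatrix (moment_matrix m) k *\<^sub>v v) \<bullet>c v =
    (\<Sum>i<k. \<Sum>j<k. cnj (v $ i) * cnj (cnj (v $ j)) * (if even j then m (i + j) else cnj (m (i + j))))"
proof -
  have "(leading_submatrix (moment_matrix m) k *\<^sub>v v) \<bullet>c v =
    (\<Sum>i<k. (\<Sum>j<k. (if even j then m (i + j) else cnj (m (i + j))) * v $ j) * cnj (v $ i))"
    using assms
    by (auto simp: scalar_prod_def mult_mat_vec_def leading_submatrix_def moment_matrix_def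
        atLeast0LessThan intro!: sum.cong)
  then show ?thesis by (simp add: sum_distrib_left sum_distrib_right mult_ac)
qed

lemma mat_adjoint_index:
  "i < dim_col A \<Longrightarrow> j < dim_row A \<Longrightarrow> mat_adjoint A $$ (i, j) = conjugate (A $$ (j, i))"
  by (simp add: mat_adjoint_def mat_of_rows_index)

lemma dim_mat_adjoint [simp]: "dim_row (mat_adjoint A) = dim_col A" "dim_col (mat_adjoint A) = dim_row A"
  by (simp_all add: mat_adjoint_def)

lemma positive_semidefinite_leading_submatrices:
  assumes "\<forall>k\<ge>1. positive_semidefinite (leading_submatrix (moment_matrix m) k)"
  shows "even k \<Longrightarrow> cnj (m k) = m k"
    and "0 \<le> Re (\<Sum>a\<le>N. \<Sum>b\<le>N. x a * cnj (x b) * (if even b then m (a + b) else cnj (m (a + b))))"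
proof -
  assume k: "even k"
  let ?A = "leading_submatrix (moment_matrix m) (Suc k)"
  have "mat_adjoint ?A = ?A" using assms by (simp add: positive_semidefinite_def)
  moreover have "dim_row ?A = Suc k" "dim_col ?A = Suc k" by (simp_all add: leading_submatrix_def)
  \<comment> \<open>For even \<open>k\<close> both corner entries are \<open>m k\<close>, so the
    Hermitian property makes it real.\<close>
  ultimately have "?A $$ (0, k) = cnj (?A $$ (k, 0))"
    using mat_adjoint_index[of 0 ?A k] by simp
  then show "cnj (m k) = m k" using k by (simp add: leading_submatrix_index)
next
  let ?A = "leading_submatrix (moment_matrix m) (Suc N)"
  let ?v = "vec (Suc N) (\<lambda>i. cnj (x i))"
  have "0 \<le> (?A *\<^sub>v ?v) \<bullet>c ?v"
    using assms by (auto simp: positive_semidefinite_def leading_submatrix_def)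
  also have "(?A *\<^sub>v ?v) \<bullet>c ?v =
      (\<Sum>a<Suc N. \<Sum>b<Suc N. x a * cnj (x b) * (if even b then m (a + b) else cnj (m (a + b))))"
    by (subst leading_submatrix_quadratic_form) (auto intro!: sum.cong)
  finally show "0 \<le> Re (\<Sum>a\<le>N. \<Sum>b\<le>N. x a * cnj (x b) * (if even b then m (a + b) else cnj (m (a + b))))"
    by (simp only: less_eq_complex_def lessThan_Suc_atMost zero_complex.sel)
qed

text \<open>Write \<open>z\<close> as radius times a unit number u: an odd power carries one u, an
  even power none. Two odd factors cancel to a real value, on which the conjugation has no
  effect.\<close>

lemma angle_power_mult_cnj:
  "angle_power z a * cnj (angle_power z b) =
    (if even b then angle_power z (a + b) else cnj (angle_power z (a + b)))"
proof -
  have zz: "z * cnj z = of_real (cmod z) * of_real (cmod z)"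
    using complex_norm_square[of z] by (simp add: power2_eq_square)
  show ?thesis
    by (cases "even a"; cases "even b") (auto elim!: evenE oddE simp: angle_power_def power_add mult_ac zz)
qed

text \<open>The quadratic form at \<open>v\<close> is the integral of the squared modulus of the
  combination of the \<open>angle_power z i\<close> with coefficients
  \<open>cnj (v $ i)\<close>.\<close>

lemma positive_semidefinite_if_moments:
  assumes \<rho>: "sets \<rho> = sets borel" "finite_moments \<rho>"
    and m: "\<And>k. m k = (\<integral>z. angle_power z k \<partial>\<rho>)"
  shows "positive_semidefinite (leading_submatrix (moment_matrix m) k)"
proof -
  note [measurable_cong] = \<rho>(1)
  have [measurable]: "(\<lambda>z. angle_power z k) \<in> borel_measurable borel" for k
    unfolding angle_power_def by measurable
  have norm: "cmod (angle_power z k) = cmod z ^ k" for z k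
    by (cases k) (auto simp: angle_power_def norm_mult norm_power)
  have int: "integrable \<rho> (\<lambda>z. angle_power z k)" for k
  proof (rule integrableI_bounded)
    show "(\<integral>\<^sup>+ z. ennreal (norm (angle_power z k)) \<partial>\<rho>) < \<infinity>"
      using \<rho>(2) by (simp add: finite_moments_def norm)
  qed simp
  define M where "M a b = (if even b then m (a + b) else cnj (m (a + b)))" for a b
  have M: "M a b = (\<integral>z. angle_power z a * cnj (angle_power z b) \<partial>\<rho>)"
    and M_int: "integrable \<rho> (\<lambda>z. angle_power z a * cnj (angle_power z b))" for a b
    using int[of "a + b"] by (cases "even b"; simp add: M_def angle_power_mult_cnj m)+
  have M_cnj: "M b a = cnj (M a b)" for a b
    unfolding M Bochner_Integration.integral_cnj[symmetric]
    by (rule Bochner_Integration.integral_cong) (simp_all add: mult.commute)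
  let ?A = "leading_submatrix (moment_matrix m) k"
  have dim: "dim_row ?A = k" "dim_col ?A = k" by (simp_all add: leading_submatrix_def)
  have idx: "?A $$ (i, j) = M i j" if "i < k" "j < k" for i j
    using that by (simp add: leading_submatrix_index M_def)
  have "mat_adjoint ?A = ?A"
    by (rule eq_matI) (simp_all add: dim mat_adjoint_index idx M_cnj[symmetric])
  moreover have "0 \<le> (?A *\<^sub>v v) \<bullet>c v" if v: "v \<in> carrier_vec (dim_row ?A)" for v
  proof -
    define f where "f z = (\<Sum>i<k. cnj (v $ i) * angle_power z i)" for z
    have "(?A *\<^sub>v v) \<bullet>c v = (\<Sum>i<k. \<Sum>j<k. cnj (v $ i) * cnj (cnj (v $ j)) * M i j)"
      using v by (subst leading_submatrix_quadratic_form) (auto simp: dim M_def)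
    also have "\<dots> = (\<integral>z. (\<Sum>i<k. \<Sum>j<k. cnj (v $ i) * cnj (cnj (v $ j)) *
        (angle_power z i * cnj (angle_power z j))) \<partial>\<rho>)"
      using M_int by (simp add: M)
    also have "\<dots> = (\<integral>z. of_real ((cmod (f z))\<^sup>2) \<partial>\<rho>)"
      unfolding complex_norm_square f_def
      by (simp add: sum_product mult_ac)
    also have "\<dots> = of_real (\<integral>z. (cmod (f z))\<^sup>2 \<partial>\<rho>)" by (rule integral_complex_of_real)
    finally show ?thesis by (simp add: less_eq_complex_def)
  qed
  ultimately show ?thesis by (simp add: positive_semidefinite_def dim)
qed

theorem theorem4p1:
  fixes m :: "nat \<Rightarrow> complex"
  assumes "m 0 = 1"
  shows "(\<exists>\<rho> :: complex measure. biradial \<rho> \<and> finite_moments \<rho> \<and>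
            (\<forall>k. m k = (\<integral>z. angle_power z k \<partial>\<rho>)))
       \<longleftrightarrow> (\<forall>k\<ge>1. positive_semidefinite (leading_submatrix (moment_matrix m) k))"
proof
  assume "\<exists>\<rho>. biradial \<rho> \<and> finite_moments \<rho> \<and> (\<forall>k. m k = (\<integral>z. angle_power z k \<partial>\<rho>))"
  then obtain \<rho> where "sets \<rho> = sets borel" "finite_moments \<rho>" "\<And>k. m k = (\<integral>z. angle_power z k \<partial>\<rho>)"
    unfolding biradial_def by blast
  then show "\<forall>k\<ge>1. positive_semidefinite (leading_submatrix (moment_matrix m) k)"
    using positive_semidefinite_if_moments by blast
next
  assume psd: "\<forall>k\<ge>1. positive_semidefinite (leading_submatrix (moment_matrix m) k)"
  have rep: "\<exists>(I :: complex set) d w h. finite I \<and> (\<forall>i\<in>I. 0 \<le> w i) \<and> (\<forall>i. cmod (h i) \<le> 1) \<and>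
      (\<forall>k\<le>n. m k = (\<Sum>i\<in>I. of_real (w i * d i ^ k) * (if even k then 1 else h i)))" for n
    by (rule truncated_representation[where m = m and n = n])
      (use positive_semidefinite_leading_submatrices[OF psd] in blast)+
  obtain S :: "real measure" and H where S: "real_distribution S" "distr S borel uminus = S"
    "\<And>k. integrable S (\<lambda>x. x ^ k)"
    and H: "H \<in> borel_measurable borel" "\<And>x. cmod (H x) \<le> 1" "\<And>x. H (- x) = - H x"
    and m: "\<And>k. m k = (\<integral>x. of_real (x ^ k) * (if even k then 1 else H x) \<partial>S)"
    by (rule limit_representation[OF assms rep]) (rule that; assumption)
  interpret S: real_distribution S by (rule S(1))
  obtain \<rho> where "biradial \<rho>" "finite_moments \<rho>"
    "\<And>k. (\<integral>z. angle_power z k \<partial>\<rho>) = (\<integral>x. of_real (x ^ k) * (if even k then 1 else H x) \<partial>S)"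
    by (rule biradial_representation[OF S.prob_space_axioms S.events_eq_borel S(2,3) H])
      (rule that; assumption)
  then show "\<exists>\<rho>. biradial \<rho> \<and> finite_moments \<rho> \<and> (\<forall>k. m k = (\<integral>z. angle_power z k \<partial>\<rho>))"
    using m by auto
qed

end
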